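(* Let $S_1\subseteq\mathbb{R}[\underline x]$ and $S_2\subseteq\mathscr{M}$, and suppose $\operatorname{QM}(S_1)$ is archimedean in $\mathbb{R}[\underline x]$. (1) For $f\in\mathscr{M}[\underline x]$ the following are equivalent: (i) $f(\mu,\underline X)\ge0$ for all $(\mu,\underline X)\in\mathbf{K}(S_1,S_2)\times K(S_1)$; (ii) $f+\varepsilon\in\operatorname{QM}(S_1,S_2)$ for all $\varepsilon>0$. (2) For $f\in\mathscr{M}$ the following are equivalent: (i') $f(\mu)\ge0$ for all $\mu\in\mathbf{K}(S_1,S_2)$; (ii') $f+\varepsilon\in\operatorname{qm}(S_1,S_2)$ for all $\varepsilon>0$.
   Context: Let $n\in\mathbb{N}$ and $\mathbb{R}[\underline x]=\mathbb{R}[x_1,\dots,x_n]$. Let $\mathscr{M}=\mathbb{R}[\mathtt{m}_{i_1,\dots,i_n}\colon (i_1,\dots,i_n)\in\mathbb{N}_0^n]$ be the polynomial ring in countably many indeterminates (formal moments), with the convention $\mathtt{m}_{0,\dots,0}:=1$, and let $\mathscr{M}[\underline x]=\mathscr{M}\otimes_{\mathbb{R}}\mathbb{R}[\underline x]$. Let $\mathtt{m}:\mathscr{M}[\underline x]\to\mathscr{M}$ be the unique $\mathscr{M}$-linear map with $\mathtt{m}(x_1^{i_1}\cdots x_n^{i_n})=\mathtt{m}_{i_1,\dots,i_n}$. A quadratic module in a commutative unital ring $A$ is a subset $M$ with $1\in M$, $M+M\subseteq M$ and $a^2M\subseteq M$ for all $a\in A$; it is archimedean if for every $a\in A$ there is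 $N\in\mathbb{N}$ with $N\pm a\in M$. For $S_1\subseteq\mathbb{R}[\underline x]$, $S_2\subseteq\mathscr{M}$: $\operatorname{QM}(S_1)$ is the quadratic module of $\mathbb{R}[\underline x]$ generated by $S_1$; $\operatorname{qm}(S_1,S_2)$ is the quadratic module of $\mathscr{M}$ generated by $\{\mathtt{m}(f^2s)\colon s\in\{1\}\cup S_1,\ f\in\mathscr{M}[\underline x]\}\cup S_2$; $\operatorname{QM}(S_1,S_2)$ is the quadratic module of $\mathscr{M}[\underline x]$ generated by $S_1\cup\{\mathtt{m}(f^2s)\colon s\in\{1\}\cup S_1,\ f\in\mathscr{M}[\underline x]\}\cup S_2$. For closed $K\subseteq\mathbb{R}^n$, $\mathbf{P}(K)$ denotes the set of Borel probability measures on $\mathbb{R}^n$ supported on $K$ with $\int x_j^{2k}\,d\mu<\infty$ for all $j$ and $k\in\mathbb{N}$. For $(\mu,\underline X)\in\mathbf{P}(\mathbb{R}^n)\times\mathbb{R}^n$ and $f\in\mathscr{M}[\underline x]$, $f(\mu,\underline X)$ is the image of $f$ under the ring homomorphism $\mathscr{M}[\underline x]\to\mathbb{R}$ determined by $\mathtt{m}_{i_1,\dots,i_n}\mapsto\int x_1^{i_1}\cdots x_n^{i_n}\,d\mu$ and $x_j\mapsto X_j$; for $f\in\mathscr{M}$ this depends only on $\mu$ and is written $f(\mu)$. Set $K(S_1)=\{\underline X\in\mathbb{R}^n\colon p(\underline X)\ge0\ \forall p\in S_1\}$ and $\mathbf{K}(S_1,S_2)=\{\mu\in\mathbf{P}(K(S_1))\colon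 s(\mu)\ge0\ \forall s\in S_2\}$. *)

theory Defs
  imports "HOL-Analysis.Analysis" "HOL-Probability.Probability" "HOL-Library.Poly_Mapping"
begin

inductive_set qmod_gen :: "'a::comm_ring_1 set \<Rightarrow> 'a set" for S :: "'a set" where
  qm_one: "1 \<in> qmod_gen S"
| qm_gen: "s \<in> S \<Longrightarrow> s \<in> qmod_gen S"
| qm_add: "a \<in> qmod_gen S \<Longrightarrow> b \<in> qmod_gen S \<Longrightarrow> a + b \<in> qmod_gen S"
| qm_sq: "b \<in> qmod_gen S \<Longrightarrow> a\<^sup>2 * b \<in> qmod_gen S"

definition archimedean_qm :: "'a::comm_ring_1 set \<Rightarrow> bool" where
  "archimedean_qm M \<longleftrightarrow> (\<forall>a. \<exists>N::nat. of_nat N + a \<in> M \<and> of_nat N - a \<in> M)"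

text \<open>Nonzero multi-indices: the indeterminates of the moment ring (m_0 is the constant 1).\<close>
typedef 'n midx = "{\<alpha> :: 'n \<Rightarrow>\<^sub>0 nat. \<alpha> \<noteq> 0}"
  proof -
  have "Poly_Mapping.lookup (Poly_Mapping.single undefined (1::nat)) undefined = 1" by simp
  then have "Poly_Mapping.single undefined (1::nat) \<noteq> 0" by (metis lookup_zero zero_neq_one)
  then show ?thesis by blast
qed

type_synonym 'n xpoly = "('n \<Rightarrow>\<^sub>0 nat) \<Rightarrow>\<^sub>0 real"
text \<open>M : polynomials in the formal moments m_alpha, alpha nonzero\<close>
type_synonym 'n mpoly = "('n midx \<Rightarrow>\<^sub>0 nat) \<Rightarrow>\<^sub>0 real"
type_synonym 'n mxpoly = "('n \<Rightarrow>\<^sub>0 nat) \<Rightarrow>\<^sub>0 'n mpoly"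

definition mconst :: "real \<Rightarrow> 'n mpoly" where
  "mconst c = Poly_Mapping.single 0 c"

definition mxconst :: "real \<Rightarrow> 'n mxpoly" where
  "mxconst c = Poly_Mapping.single 0 (mconst c)"

definition M_to_MX :: "'n mpoly \<Rightarrow> 'n mxpoly" where
  "M_to_MX g = Poly_Mapping.single 0 g"

definition X_to_MX :: "'n xpoly \<Rightarrow> 'n mxpoly" where
  "X_to_MX p = Poly_Mapping.map mconst p"

definition mvar :: "('n \<Rightarrow>\<^sub>0 nat) \<Rightarrow> 'n mpoly" where
  "mvar \<alpha> = (if \<alpha> = 0 then 1 else Poly_Mapping.single (Poly_Mapping.single (Abs_midx \<alpha>) 1) 1)"

definition mom_map :: "'n mxpoly \<Rightarrow> 'n mpoly" where
  "mom_map f = (\<Sum>\<alpha>\<in>Poly_Mapping.keys f. Poly_Mapping.lookup f \<alpha> * mvar \<alpha>)"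

definition QM1 :: "'n xpoly set \<Rightarrow> 'n xpoly set" where
  "QM1 S1 = qmod_gen S1"

definition mom_gens :: "'n xpoly set \<Rightarrow> 'n mpoly set" where
  "mom_gens S1 = {mom_map (f\<^sup>2 * X_to_MX s) | f s. s \<in> insert 1 S1}"

definition qm :: "'n xpoly set \<Rightarrow> 'n mpoly set \<Rightarrow> 'n mpoly set" where
  "qm S1 S2 = qmod_gen (mom_gens S1 \<union> S2)"

definition QM2 :: "'n xpoly set \<Rightarrow> 'n mpoly set \<Rightarrow> 'n mxpoly set" where
  "QM2 S1 S2 = qmod_gen (X_to_MX ` S1 \<union> M_to_MX ` mom_gens S1 \<union> M_to_MX ` S2)"

definition xmono :: "('n::finite \<Rightarrow>\<^sub>0 nat) \<Rightarrow> real^'n \<Rightarrow> real" where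
  "xmono \<alpha> X = (\<Prod>i\<in>UNIV. (X $ i) ^ Poly_Mapping.lookup \<alpha> i)"

definition moment :: "(real^'n::finite) measure \<Rightarrow> ('n \<Rightarrow>\<^sub>0 nat) \<Rightarrow> real" where
  "moment \<mu> \<alpha> = (\<integral>x. xmono \<alpha> x \<partial>\<mu>)"

definition eval_x :: "'n::finite xpoly \<Rightarrow> real^'n \<Rightarrow> real" where
  "eval_x p X = (\<Sum>\<alpha>\<in>Poly_Mapping.keys p. Poly_Mapping.lookup p \<alpha> * xmono \<alpha> X)"

definition eval_m :: "(real^'n::finite) measure \<Rightarrow> 'n mpoly \<Rightarrow> real" where
  "eval_m \<mu> g = (\<Sum>\<beta>\<in>Poly_Mapping.keys g. Poly_Mapping.lookup g \<beta> *
      (\<Prod>\<gamma>\<in>Poly_Mapping.keys \<beta>. moment \<mu> (Rep_midx \<gamma>) ^ Poly_Mapping.lookup \<beta> \<gamma>))"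

definition eval_mx :: "(real^'n::finite) measure \<Rightarrow> real^'n \<Rightarrow> 'n mxpoly \<Rightarrow> real" where
  "eval_mx \<mu> X f = (\<Sum>\<alpha>\<in>Poly_Mapping.keys f. eval_m \<mu> (Poly_Mapping.lookup f \<alpha>) * xmono \<alpha> X)"

definition Pmeas :: "(real^'n::finite) set \<Rightarrow> (real^'n) measure set" where
  "Pmeas K = {\<mu>. sets \<mu> = sets borel \<and> prob_space \<mu> \<and> emeasure \<mu> (UNIV - K) = 0 \<and>
      (\<forall>j k. integrable \<mu> (\<lambda>x. (x $ j) ^ (2 * k)))}"

definition Kset :: "'n::finite xpoly set \<Rightarrow> (real^'n) set" where
  "Kset S1 = {X. \<forall>p\<in>S1. eval_x p X \<ge> 0}"

definition Kmeas :: "'n::finite xpoly set \<Rightarrow> 'n mpoly set \<Rightarrow> (real^'n) measure set" where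
  "Kmeas S1 S2 = {\<mu> \<in> Pmeas (Kset S1). \<forall>s\<in>S2. eval_m \<mu> s \<ge> 0}"

end

theory Submission
  imports Defs
begin

text \<open>
  Both equivalences rest on the archimedean Positivstellensatz: if an archimedean quadratic module \<open>M\<close> of a
  real algebra is such that \<open>f\<close> is nonnegative under all real characters that are nonnegative on \<open>M\<close>,
  then \<open>f + \<epsilon> \<in> M\<close> for all \<open>\<epsilon> > 0\<close>. Applying the formal moment map to certificates
  \<open>N \<plusminus> x\<^sup>\<alpha> \<in> QM(S1)\<close> bounds every formal moment, so \<open>qm(S1, S2)\<close> and \<open>QM(S1, S2)\<close>
  inherit archimedeanity. A character of the moment ring that is nonnegative on \<open>qm(S1, S2)\<close> yields a
  functional on polynomials that is nonnegative on those that are nonnegative on the compact set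
  \<open>K(S1)\<close>; solving this moment problem shows that the character is evaluation at some
  \<open>\<mu> \<in> K(S1, S2)\<close>.

  The moment problem is solved without the Riesz representation theorem. Averages of point evaluations on
  the compact set, chosen greedily, approximate any finitely many prescribed moments. The compact set is then
  coded in the real line by a map that has a continuous left inverse, so that Helly's selection theorem on the
  line provides a limit measure.
\<close>

section \<open>Archimedean quadratic modules\<close>

definition quadratic_module :: "'a::comm_ring_1 set \<Rightarrow> bool" where
  "quadratic_module M \<longleftrightarrow> 1 \<in> M \<and> (\<forall>a\<in>M. \<forall>b\<in>M. a + b \<in> M) \<and> (\<forall>a. \<forall>b\<in>M. a\<^sup>2 * b \<in> M)"

lemma quadratic_moduleD:
  assumes "quadratic_module M"
  shows "1 \<in> M" "a \<in> M \<Longrightarrow> b \<in> M \<Longrightarrow> a + b \<in> M" "b \<in> M \<Longrightarrow> a\<^sup>2 * b \<in> M"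
  using assms by (auto simp: quadratic_module_def)

lemma quadratic_module_qmod_gen: "quadratic_module (qmod_gen S)"
  by (auto simp: quadratic_module_def intro: qmod_gen.intros)

text \<open>The quadratic module generated by nothing consists of the sums of squares, so
  \<open>qmod_gen {}\<close> stands for them from here on.\<close>

lemma quadratic_module_sos_mult:
  assumes M: "quadratic_module M" and "m \<in> M" "s \<in> qmod_gen {}"
  shows "s * m \<in> M"
  using assms(3)
  by induction (use assms(1,2) in \<open>auto simp: quadratic_module_def distrib_right mult.assoc\<close>)

lemma zero_in_quadratic_module: "quadratic_module M \<Longrightarrow> 0 \<in> M"
  using quadratic_moduleD(3)[of M 1 0] quadratic_moduleD(1)[of M] by simp

text \<open>This is the one-step extension of \<open>M\<close> by \<open>g\<close>: it is compared
  with \<open>M\<close> when \<open>M\<close> is maximal, and taken at \<open>- g\<close> in the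
  Positivstellensatz.\<close>

lemma quadratic_module_adjoin:
  assumes "quadratic_module M"
  shows "quadratic_module {q + s * g | q s. q \<in> M \<and> s \<in> qmod_gen {}}" (is "quadratic_module ?N")
    and "M \<subseteq> {q + s * g | q s. q \<in> M \<and> s \<in> qmod_gen {}}"
    and "g \<in> {q + s * g | q s. q \<in> M \<and> s \<in> qmod_gen {}}"
proof -
  have z: "0 \<in> qmod_gen {}"
    by (rule zero_in_quadratic_module[OF quadratic_module_qmod_gen])
  show sub: "M \<subseteq> ?N"
    using z by (force intro: exI[of _ "0::'a"])
  show "g \<in> ?N"
    using zero_in_quadratic_module[OF assms] qm_one by force
  show "quadratic_module ?N"
    unfolding quadratic_module_def
  proof (intro conjI ballI allI)
    show "1 \<in> ?N"
      using sub quadratic_moduleD(1)[OF assms] by blast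
  next
    fix a b assume "a \<in> ?N" "b \<in> ?N"
    then obtain q s q' s' where *: "a = q + s * g" "b = q' + s' * g"
      "q \<in> M" "q' \<in> M" "s \<in> qmod_gen {}" "s' \<in> qmod_gen {}"
      by blast
    have "a + b = (q + q') + (s + s') * g"
      by (simp add: * algebra_simps)
    then show "a + b \<in> ?N"
      using * quadratic_moduleD(2)[OF assms] qm_add by blast
  next
    fix a b assume "b \<in> ?N"
    then obtain q s where *: "b = q + s * g" "q \<in> M" "s \<in> qmod_gen {}"
      by blast
    have "a\<^sup>2 * b = a\<^sup>2 * q + (a\<^sup>2 * s) * g"
      by (simp add: * algebra_simps)
    then show "a\<^sup>2 * b \<in> ?N"
      using * quadratic_moduleD(3)[OF assms] qm_sq by blast
  qed
qed

text \<open>Zorn's lemma applies because properness is the condition that -1 is missing, which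
  survives unions of chains.\<close>

lemma maximal_quadratic_module:
  fixes M :: "'a::comm_ring_1 set"
  assumes M: "quadratic_module M" "- 1 \<notin> M"
  obtains Q where "quadratic_module Q" "- 1 \<notin> Q" "M \<subseteq> Q"
    "\<And>Q'. quadratic_module Q' \<Longrightarrow> Q \<subseteq> Q' \<Longrightarrow> - 1 \<notin> Q' \<Longrightarrow> Q' = Q"
proof -
  define A where "A = {Q :: 'a set. quadratic_module Q \<and> - 1 \<notin> Q \<and> M \<subseteq> Q}"
  have "\<exists>Q\<in>A. \<forall>X\<in>A. Q \<subseteq> X \<longrightarrow> X = Q"
  proof (rule subset_Zorn_nonempty)
    show "A \<noteq> {}"
      using M by (auto simp: A_def)
  next
    fix C assume C: "C \<noteq> {}" "subset.chain A C"
    then have CA: "\<And>X. X \<in> C \<Longrightarrow> quadratic_module X \<and> - 1 \<notin> X \<and> M \<subseteq> X"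
      by (auto simp: subset_chain_def A_def)
    have "a + b \<in> \<Union>C" if ab: "a \<in> \<Union>C" "b \<in> \<Union>C" for a b
    proof -
      obtain X Y where XY: "X \<in> C" "Y \<in> C" "a \<in> X" "b \<in> Y"
        using ab by blast
      then have "X \<subseteq> Y \<or> Y \<subseteq> X"
        using C by (auto simp: subset_chain_def)
      then show ?thesis
        using XY CA[of X] CA[of Y] quadratic_moduleD(2) by blast
    qed
    moreover have "a\<^sup>2 * b \<in> \<Union>C" if "b \<in> \<Union>C" for a b
      using that CA quadratic_moduleD(3) by blast
    moreover obtain X where "X \<in> C" using C by blast
    ultimately have "quadratic_module (\<Union>C)"
      unfolding quadratic_module_def using CA[of X] quadratic_moduleD(1) by blast
    then show "\<Union>C \<in> A"
      using CA \<open>X \<in> C\<close> by (auto simp: A_def)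
  qed
  then show ?thesis
    using that by (auto simp: A_def)
qed

section \<open>Real scalars and bounded elements\<close>

text \<open>The real algebra structure is abstracted into a unital ring homomorphism
  \<open>c\<close>, so that one Positivstellensatz serves the polynomial ring, the moment ring and
  the mixed ring.\<close>

locale real_scalars =
  fixes c :: "real \<Rightarrow> 'a::comm_ring_1"
  assumes c_add: "c (r + s) = c r + c s"
    and c_mult: "c (r * s) = c r * c s"
    and c_one: "c 1 = 1"
begin

lemma c_zero: "c 0 = 0"
  using c_add[of 0 0] by simp

lemma c_minus: "c (- r) = - c r"
  using c_add[of r "- r"] by (simp add: c_zero add_eq_0_iff)

lemma c_diff: "c (r - s) = c r - c s"
  using c_add[of r "- s"] by (simp add: c_minus)

lemma c_of_nat: "c (real n) = of_nat n"
  by (induction n) (simp_all add: c_zero c_add c_one)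

lemma c_power: "c (r ^ n) = c r ^ n"
  by (induction n) (simp_all add: c_one c_mult)

text \<open>A nonnegative real is a square, and so is its image under \<open>c\<close>.\<close>

lemma qm_scale:
  assumes "quadratic_module M" "x \<in> M" "0 \<le> r"
  shows "c r * x \<in> M"
proof -
  have "c r = (c (sqrt r))\<^sup>2"
    using assms(3) by (simp flip: c_power)
  then show ?thesis
    using quadratic_moduleD(3)[OF assms(1,2)] by simp
qed

lemma qm_const: "quadratic_module M \<Longrightarrow> 0 \<le> r \<Longrightarrow> c r \<in> M"
  using qm_scale[of M 1 r] quadratic_moduleD(1)[of M] by simp

lemma qm_neg_const:
  assumes "quadratic_module M" "c r \<in> M" "r < 0"
  shows "- 1 \<in> M"
proof -
  have "c (- 1 / r) * c r = - 1"
    using assms(3) by (simp add: c_minus c_one flip: c_mult)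
  then show ?thesis
    using qm_scale[OF assms(1,2), of "- 1 / r"] assms(3) by (simp add: field_simps)
qed

lemma qm_mono_const:
  assumes "quadratic_module M" "c r + x \<in> M" "r \<le> s"
  shows "c s + x \<in> M"
proof -
  have "c s + x = c (s - r) + (c r + x)"
    by (simp add: c_diff)
  then show ?thesis
    using quadratic_moduleD(2)[OF assms(1) qm_const[OF assms(1), of "s - r"] assms(2)] assms(3)
    by (simp only: diff_ge_0_iff_ge)
qed

text \<open>The elements bounded relative to \<open>M\<close>. For a quadratic module they form a
  subalgebra, which reduces archimedeanity to a check on generators.\<close>

definition bdd :: "'a set \<Rightarrow> 'a set" where
  "bdd M = {a. \<exists>r. c r + a \<in> M \<and> c r - a \<in> M}"

lemma bddE:
  assumes "quadratic_module M" "a \<in> bdd M"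
  obtains r where "r > 0" "c r + a \<in> M" "c r - a \<in> M"
proof -
  obtain r where r: "c r + a \<in> M" "c r - a \<in> M"
    using assms(2) by (auto simp: bdd_def)
  show ?thesis
    using that[of "max r 1"] qm_mono_const[OF assms(1) r(1), of "max r 1"]
      qm_mono_const[OF assms(1), of r "- a" "max r 1"] r(2) by simp
qed

lemma archimedean_qm_iff:
  assumes "quadratic_module M"
  shows "archimedean_qm M \<longleftrightarrow> bdd M = UNIV"
proof
  assume "archimedean_qm M"
  then show "bdd M = UNIV"
    by (fastforce simp: archimedean_qm_def bdd_def simp flip: c_of_nat)
next
  assume *: "bdd M = UNIV"
  show "archimedean_qm M"
    unfolding archimedean_qm_def
  proof
    fix a
    obtain r where r: "c r + a \<in> M" "c r - a \<in> M"
      using * by (auto simp: bdd_def)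
    obtain N where N: "r \<le> real N"
      using real_arch_simple by blast
    show "\<exists>N::nat. of_nat N + a \<in> M \<and> of_nat N - a \<in> M"
      using qm_mono_const[OF assms r(1) N] qm_mono_const[OF assms, of r "- a" "real N"] r(2) N
      by (intro exI[of _ N]) (simp add: c_of_nat)
  qed
qed

lemma bdd_const: "quadratic_module M \<Longrightarrow> c r \<in> bdd M"
  using qm_const[of M "\<bar>r\<bar> + r"] qm_const[of M "\<bar>r\<bar> - r"]
  by (auto simp: bdd_def c_add c_diff intro!: exI[of _ "\<bar>r\<bar>"])

lemma bdd_uminus: "a \<in> bdd M \<Longrightarrow> - a \<in> bdd M"
  by (auto simp: bdd_def)

lemma bdd_add:
  assumes "quadratic_module M" "a \<in> bdd M" "b \<in> bdd M"
  shows "a + b \<in> bdd M"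
proof -
  obtain r s where "c r + a \<in> M" "c r - a \<in> M" "c s + b \<in> M" "c s - b \<in> M"
    using assms by (auto simp: bdd_def)
  then have "(c r + a) + (c s + b) \<in> M" "(c r - a) + (c s - b) \<in> M"
    using quadratic_moduleD(2)[OF assms(1)] by blast+
  then show ?thesis
    by (auto simp: bdd_def c_add algebra_simps intro!: exI[of _ "r + s"])
qed

text \<open>The product (r + a)(r - a) of two members need not be a member. Weighting each factor by
  the square of the other and adding gives 2 r (r^2 - a^2), which is one.\<close>

lemma qm_square_bound:
  assumes M: "quadratic_module M" and r: "c r + a \<in> M" "c r - a \<in> M" "r > 0"
  shows "c (r\<^sup>2) - a\<^sup>2 \<in> M"
proof -
  have "(c r + a)\<^sup>2 * (c r - a) + (c r - a)\<^sup>2 * (c r + a) \<in> M"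
    using r quadratic_moduleD[OF M] by blast
  then have "c (1 / (2 * r)) * ((c r + a)\<^sup>2 * (c r - a) + (c r - a)\<^sup>2 * (c r + a)) \<in> M"
    using qm_scale[OF M] r(3) by simp
  moreover have "(c r + a)\<^sup>2 * (c r - a) + (c r - a)\<^sup>2 * (c r + a) = (c r + c r) * (c (r\<^sup>2) - a\<^sup>2)"
    by (simp add: c_mult power2_eq_square algebra_simps)
  moreover have "c (1 / (2 * r)) * (c r + c r) = 1"
    using r(3) by (simp add: c_one flip: c_mult c_add)
  ultimately show ?thesis
    by (simp flip: mult.assoc)
qed

lemma bdd_square:
  assumes M: "quadratic_module M" "a \<in> bdd M"
  shows "a\<^sup>2 \<in> bdd M"
proof -
  obtain r where r: "r > 0" "c r + a \<in> M" "c r - a \<in> M"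
    using bddE[OF assms] by blast
  have "c (r\<^sup>2) + a\<^sup>2 \<in> M"
    using qm_const[OF M(1), of "r\<^sup>2"] quadratic_moduleD[OF M(1)] by (metis mult.right_neutral zero_le_power2)
  then show ?thesis
    using qm_square_bound[OF M(1) r(2,3,1)] by (auto simp: bdd_def)
qed

lemma c_half: "c (1/2) + c (1/2) = 1"
  by (simp add: c_one flip: c_add)

text \<open>Quadratic modules absorb only squares; this lets an arbitrary factor act on an element
  whose negative is a member as well.\<close>

lemma diff_of_squares: "b = (c (1/2) * (b + 1))\<^sup>2 - (c (1/2) * (b - 1))\<^sup>2"
proof -
  define h where "h = c (1/2)"
  have "(h * (b + 1))\<^sup>2 - (h * (b - 1))\<^sup>2 = (h + h) * ((h + h) * b)"
    by (simp add: power2_eq_square algebra_simps)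
  then show ?thesis
    by (simp add: h_def c_half)
qed

lemma polarization: "a * b = (c (1/2) * (a + b))\<^sup>2 - (c (1/2) * (a - b))\<^sup>2"
proof -
  define h where "h = c (1/2)"
  have "(h * (a + b))\<^sup>2 - (h * (a - b))\<^sup>2 = (h + h) * ((h + h) * (a * b))"
    by (simp add: power2_eq_square algebra_simps)
  then show ?thesis
    by (simp add: h_def c_half)
qed

lemma bdd_scale:
  assumes M: "quadratic_module M" "a \<in> bdd M"
  shows "c t * a \<in> bdd M"
proof -
  have *: "c t * a \<in> bdd M" if "t \<ge> 0" for t
  proof -
    obtain r where r: "c r + a \<in> M" "c r - a \<in> M"
      using assms(2) by (auto simp: bdd_def)
    show ?thesis
      using qm_scale[OF M(1) r(1) that] qm_scale[OF M(1) r(2) that]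
      by (auto simp: bdd_def algebra_simps c_mult intro!: exI[of _ "r * t"])
  qed
  show ?thesis
    using *[of t] bdd_uminus[OF *[of "- t"]] by (cases "t \<ge> 0") (auto simp: c_minus)
qed

lemma bdd_diff:
  assumes "quadratic_module M" "a \<in> bdd M" "b \<in> bdd M"
  shows "a - b \<in> bdd M"
  using bdd_add[OF assms(1,2) bdd_uminus[OF assms(3)]] by simp

text \<open>Polarization reduces products to squares, for which a bound is already known.\<close>

lemma bdd_mult:
  assumes M: "quadratic_module M" "a \<in> bdd M" "b \<in> bdd M"
  shows "a * b \<in> bdd M"
  by (subst polarization) (intro bdd_diff bdd_square bdd_scale bdd_add M)

lemma bdd_sum:
  assumes "quadratic_module M" "\<And>i. i \<in> I \<Longrightarrow> f i \<in> bdd M"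
  shows "sum f I \<in> bdd M"
  using assms(2)
  by (induction I rule: infinite_finite_induct)
     (auto simp: bdd_add[OF assms(1)] bdd_const[OF assms(1), of 0, unfolded c_zero])

lemma bdd_power:
  "quadratic_module M \<Longrightarrow> a \<in> bdd M \<Longrightarrow> a ^ n \<in> bdd M"
  by (induction n) (use bdd_const[of M 1] in \<open>auto simp: c_one bdd_mult\<close>)

lemma bdd_prod:
  assumes "quadratic_module M" "\<And>i. i \<in> I \<Longrightarrow> f i \<in> bdd M"
  shows "prod f I \<in> bdd M"
  using assms(2)
  by (induction I rule: infinite_finite_induct)
     (use bdd_const[OF assms(1), of 1] in \<open>auto simp: bdd_mult[OF assms(1)] c_one\<close>)

text \<open>If neither \<open>a\<close> nor \<open>- a\<close> lay in \<open>Q\<close>, then \<open>-1 = q + s a = q' - s' a\<close> with sums of squares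
  \<open>s, s'\<close>, whence \<open>s + s' + s' q + s q' = 0\<close>, so that \<open>s\<close> lies in the ideal \<open>Q \<inter> -Q\<close>.\<close>
lemma maximal_quadratic_module_total:
  fixes Q :: "'a set"
  assumes Q: "quadratic_module Q" "- 1 \<notin> Q"
    and max: "\<And>Q'. quadratic_module Q' \<Longrightarrow> Q \<subseteq> Q' \<Longrightarrow> - 1 \<notin> Q' \<Longrightarrow> Q' = Q"
  shows "a \<in> Q \<or> - a \<in> Q"
proof (rule ccontr)
  assume neg: "\<not> (a \<in> Q \<or> - a \<in> Q)"
  have "\<exists>q s. - 1 = q + s * b \<and> q \<in> Q \<and> s \<in> qmod_gen {}" if "b \<notin> Q" for b
  proof (rule ccontr)
    assume "\<not> ?thesis"
    then have "- 1 \<notin> {q + s * b | q s. q \<in> Q \<and> s \<in> qmod_gen {}}"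
      by blast
    from max[OF quadratic_module_adjoin(1,2)[OF Q(1), of b] this]
      quadratic_module_adjoin(3)[OF Q(1), of b] that show False by blast
  qed
  from this[of a] this[of "- a"] neg obtain q s q' s' where
    1: "- 1 = q + s * a" "q \<in> Q" "s \<in> qmod_gen {}" and
    2: "- 1 = q' - s' * a" "q' \<in> Q" "s' \<in> qmod_gen {}"
    by (metis mult_minus_right add_uminus_conv_diff)
  have "1 + q = - (s * a)" "1 + q' = s' * a"
    using arg_cong[OF 1(1), of "\<lambda>x. q - x"] arg_cong[OF 2(1), of "\<lambda>x. q' - x"]
    by (simp_all add: add.commute)
  then have "s' * (1 + q) + s * (1 + q') = 0"
    by (simp add: mult.left_commute)
  then have "s + (s' * 1 + s' * q + s * q') = 0"
    by (simp add: algebra_simps)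
  then have "- s = s' * 1 + s' * q + s * q'"
    by (rule minus_unique)
  then have ns: "- s \<in> Q"
    using quadratic_module_sos_mult[OF Q(1)] 1 2 quadratic_moduleD[OF Q(1)] by metis
  have s: "s \<in> Q"
    using quadratic_module_sos_mult[OF Q(1) quadratic_moduleD(1)[OF Q(1)] 1(3)] by simp
  \<comment> \<open>Since both \<open>s\<close> and \<open>- s\<close> are in \<open>Q\<close>, the
    factor \<open>a\<close>, written as a difference of squares, may be multiplied in. Then -1 = q +
    s a falls into \<open>Q\<close>.\<close>
  define u v where "u = c (1/2) * (a + 1)" and "v = c (1/2) * (a - 1)"
  have "a = u\<^sup>2 - v\<^sup>2"
    unfolding u_def v_def by (rule diff_of_squares)
  then have "s * a = s * (u\<^sup>2 - v\<^sup>2)"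
    by simp
  also have "\<dots> = u\<^sup>2 * s + v\<^sup>2 * (- s)"
    by (simp add: algebra_simps)
  finally have "s * a \<in> Q"
    using s ns quadratic_moduleD[OF Q(1)] by metis
  then show False
    using 1 Q(2) quadratic_moduleD(2)[OF Q(1)] by simp
qed

section \<open>Real characters and the Positivstellensatz\<close>

definition real_hom :: "('a \<Rightarrow> real) \<Rightarrow> bool" where
  "real_hom \<phi> \<longleftrightarrow> (\<forall>r. \<phi> (c r) = r) \<and> (\<forall>a b. \<phi> (a + b) = \<phi> a + \<phi> b) \<and> (\<forall>a b. \<phi> (a * b) = \<phi> a * \<phi> b)"

lemma real_homD:
  assumes "real_hom \<phi>"
  shows "\<phi> (c r) = r" "\<phi> (a + b) = \<phi> a + \<phi> b" "\<phi> (a * b) = \<phi> a * \<phi> b"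
    "\<phi> 0 = 0" "\<phi> 1 = 1" "\<phi> (- a) = - \<phi> a" "\<phi> (a - b) = \<phi> a - \<phi> b" "\<phi> (a ^ n) = \<phi> a ^ n"
proof -
  show *: "\<phi> (c r) = r" "\<phi> (a + b) = \<phi> a + \<phi> b" "\<phi> (a * b) = \<phi> a * \<phi> b" for r a b
    using assms by (auto simp: real_hom_def)
  show 0: "\<phi> 0 = 0" and 1: "\<phi> 1 = 1"
    using *(1)[of 0] *(1)[of 1] by (simp_all add: c_zero c_one)
  show m: "\<phi> (- a) = - \<phi> a" for a
    using *(2)[of a "- a"] 0 by simp
  show "\<phi> (a - b) = \<phi> a - \<phi> b"
    using *(2)[of a "- b"] m by simp
  show "\<phi> (a ^ n) = \<phi> a ^ n"
    by (induction n) (simp_all add: 1 *)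
qed

lemma real_hom_sum: "real_hom \<phi> \<Longrightarrow> \<phi> (sum f I) = (\<Sum>i\<in>I. \<phi> (f i))"
  by (induction I rule: infinite_finite_induct) (simp_all add: real_homD)

lemma real_hom_prod: "real_hom \<phi> \<Longrightarrow> \<phi> (prod f I) = (\<Prod>i\<in>I. \<phi> (f i))"
  by (induction I rule: infinite_finite_induct) (simp_all add: real_homD)

text \<open>This is the source of the easy direction of both equivalences.\<close>

lemma qmod_gen_nonneg:
  assumes \<phi>: "real_hom \<phi>" and S: "\<And>s. s \<in> S \<Longrightarrow> \<phi> s \<ge> 0" and "a \<in> qmod_gen S"
  shows "\<phi> a \<ge> 0"
  using assms(3) by induction (simp_all add: S real_homD[OF \<phi>])

text \<open>On a total archimedean module the Dedekind cut \<open>{r. a - r \<in> Q}\<close> defines an additive map \<open>\<phi>\<close>;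
  it is multiplicative because \<open>\<epsilon> \<plusminus> a \<in> Q\<close> forces \<open>\<epsilon>\<^sup>2 - a\<^sup>2 \<in> Q\<close>.\<close>
lemma total_quadratic_module_real_hom:
  assumes Q: "quadratic_module Q" "- 1 \<notin> Q" "bdd Q = UNIV"
    and total: "\<And>a. a \<in> Q \<or> - a \<in> Q"
  obtains \<phi> where "real_hom \<phi>" "\<And>a. a \<in> Q \<Longrightarrow> \<phi> a \<ge> 0"
proof -
  note [simp] = c_add c_diff c_minus c_zero
  \<comment> \<open>\<open>near a t\<close> makes \<open>t\<close> the value of \<open>a\<close> at
    \<open>Q\<close>: modulo \<open>Q\<close>, the difference is bounded by every positive
    constant.\<close>
  define near where "near a t \<longleftrightarrow> (\<forall>e>0. c e + (a - c t) \<in> Q \<and> c e - (a - c t) \<in> Q)" for a t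
  have ex: "\<exists>t. near a t" for a
  proof -
    define R where "R = {r. a - c r \<in> Q}"
    obtain r where r: "c r + a \<in> Q" "c r - a \<in> Q"
      using Q(3) by (auto simp: bdd_def)
    have "- r \<in> R"
      using r by (simp add: R_def add.commute)
    have "x \<le> r" if "x \<in> R" for x
    proof (rule ccontr)
      assume "\<not> x \<le> r"
      moreover have "c (r - x) \<in> Q"
        using quadratic_moduleD(2)[OF Q(1) r(2), of "a - c x"] that by (simp add: R_def)
      ultimately show False
        using qm_neg_const[OF Q(1), of "r - x"] Q(2) by auto
    qed
    then have R: "bdd_above R" "R \<noteq> {}"
      using \<open>- r \<in> R\<close> by (auto simp: bdd_above_def)
    have "near a (Sup R)"
      unfolding near_def
    proof (intro allI impI conjI)
      fix e :: real assume "e > 0"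
      then obtain x where "x \<in> R" "Sup R - e < x"
        using less_cSup_iff[OF R(2,1), of "Sup R - e"] by auto
      then show "c e + (a - c (Sup R)) \<in> Q"
        using qm_mono_const[OF Q(1), of "- x" a "e - Sup R"] by (simp add: R_def algebra_simps)
      \<comment> \<open>Totality enters here: beyond the cut, the negated difference must lie in
        \<open>Q\<close>.\<close>
      have "Sup R + e \<notin> R"
        using cSup_upper[OF _ R(1), of "Sup R + e"] \<open>e > 0\<close> by auto
      then have "- (a - c (Sup R + e)) \<in> Q"
        using total[of "a - c (Sup R + e)"] by (simp add: R_def)
      then show "c e - (a - c (Sup R)) \<in> Q"
        by (simp add: algebra_simps)
    qed
    then show ?thesis ..
  qed
  have nonneg: "t \<ge> 0" if "near a t" "a \<in> Q" for a t
  proof (rule ccontr)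
    assume "\<not> t \<ge> 0"
    \<comment> \<open>With tolerance -t/2, adding \<open>a\<close> leaves the constant t/2, which is
      negative.\<close>
    then have "c (- t / 2) - (a - c t) \<in> Q"
      using that(1) unfolding near_def by (metis half_gt_zero minus_divide_left neg_0_less_iff_less not_le)
    then have "c (- t / 2 + t) \<in> Q"
      using quadratic_moduleD(2)[OF Q(1) _ that(2)] by (metis (no_types) c_add add.commute diff_add_cancel diff_diff_eq2 diff_add_eq)
    then show False
      using qm_neg_const[OF Q(1), of "- t / 2 + t"] Q(2) \<open>\<not> t \<ge> 0\<close> by simp
  qed
  have add: "near (a + b) (t + s)" if "near a t" "near b s" for a b t s
    unfolding near_def
  proof (intro allI impI)
    fix e :: real assume "e > 0"
    then have *: "c (e/2) + (a - c t) \<in> Q" "c (e/2) - (a - c t) \<in> Q"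
      "c (e/2) + (b - c s) \<in> Q" "c (e/2) - (b - c s) \<in> Q"
      using that by (auto simp: near_def)
    have e: "c (e/2) + c (e/2) = c e"
      by (simp flip: c_add)
    have eq: "c e + (a + b - c (t + s)) = (c (e/2) + (a - c t)) + (c (e/2) + (b - c s))"
      "c e - (a + b - c (t + s)) = (c (e/2) - (a - c t)) + (c (e/2) - (b - c s))"
      by (simp_all add: algebra_simps flip: e)
    show "c e + (a + b - c (t + s)) \<in> Q \<and> c e - (a + b - c (t + s)) \<in> Q"
      unfolding eq by (intro conjI quadratic_moduleD(2)[OF Q(1)] *)
  qed
  have const: "near (c r) r" for r
    using qm_const[OF Q(1)] by (simp add: near_def)
  have minus: "near (- a) (- t)" if "near a t" for a t
    using that by (auto simp: near_def algebra_simps)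
  have scale: "near (c r * a) (r * t)" if "near a t" for a t r
  proof -
    have *: "near (c r * a) (r * t)" if "r > 0" for r
      unfolding near_def
    proof (intro allI impI)
      fix e :: real assume "e > 0"
      then have "c (e / r) + (a - c t) \<in> Q" "c (e / r) - (a - c t) \<in> Q"
        using \<open>near a t\<close> that by (auto simp: near_def)
      from this[THEN qm_scale[OF Q(1), of _ r]]
      have "c r * (c (e / r) + (a - c t)) \<in> Q" "c r * (c (e / r) - (a - c t)) \<in> Q"
        using that by auto
      moreover have "c r * c (e / r) = c e"
        using that by (simp flip: c_mult)
      ultimately show "c e + (c r * a - c (r * t)) \<in> Q \<and> c e - (c r * a - c (r * t)) \<in> Q"
        by (simp add: c_mult algebra_simps)
    qed
    show ?thesis
      using *[of r] minus[OF *[of "- r"]] const[of 0]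
      by (cases r "0::real" rule: linorder_cases) auto
  qed
  have square0: "near (a\<^sup>2) 0" if "near a 0" for a
    unfolding near_def
  proof (intro allI impI)
    fix e :: real assume "e > 0"
    then have *: "c (sqrt e) + a \<in> Q" "c (sqrt e) - a \<in> Q"
      using that by (auto simp: near_def)
    have "c e - a\<^sup>2 \<in> Q"
      using qm_square_bound[OF Q(1) *] \<open>e > 0\<close> by simp
    moreover have "a\<^sup>2 \<in> Q"
      using quadratic_moduleD[OF Q(1)] by (metis mult.right_neutral)
    ultimately show "c e + (a\<^sup>2 - c 0) \<in> Q \<and> c e - (a\<^sup>2 - c 0) \<in> Q"
      using qm_const[OF Q(1), of e] quadratic_moduleD(2)[OF Q(1)] \<open>e > 0\<close> by simp
  qed
  \<comment> \<open>Both t - s and s - t are values of 0, which lies in \<open>Q\<close>, so both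
    are nonnegative.\<close>
  have uniq: "t = s" if "near a t" "near a s" for a t s
    using nonneg[OF add[OF that(1) minus[OF that(2)]]] nonneg[OF add[OF that(2) minus[OF that(1)]]]
      zero_in_quadratic_module[OF Q(1)] by simp
  have square: "near (a\<^sup>2) (t\<^sup>2)" if "near a t" for a t
  proof -
    \<comment> \<open>The square is so far understood only at value 0. Shifting by \<open>t\<close>
      reaches that case, and (a - t)^2 + 2 t a - t^2 gives back a^2.\<close>
    have a0: "near (a - c t) 0"
      using add[OF that const[of "- t"]] by simp
    have "near ((a - c t)\<^sup>2 + (c (2 * t) * a + c (- (t\<^sup>2)))) (0 + (2 * t * t + - (t\<^sup>2)))"
      by (intro add square0 a0 scale const that)
    also have "c (2 * t) = c t + c t"
      by (simp flip: c_add)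
    also have "(a - c t)\<^sup>2 + ((c t + c t) * a + c (- (t\<^sup>2))) = a\<^sup>2"
      by (simp add: power2_eq_square algebra_simps c_mult)
    also have "0 + (2 * t * t + - (t\<^sup>2)) = t\<^sup>2"
      by (simp add: power2_eq_square)
    finally show ?thesis .
  qed
  have mult: "near (a * b) (t * s)" if "near a t" "near b s" for a b t s
  proof -
    have "near ((c (1/2) * (a + b))\<^sup>2 + - (c (1/2) * (a + - b))\<^sup>2)
       ((1/2 * (t + s))\<^sup>2 + - (1/2 * (t + - s))\<^sup>2)"
      by (intro add square scale minus that)
    also have "(c (1/2) * (a + b))\<^sup>2 + - (c (1/2) * (a + - b))\<^sup>2 = a * b"
      using polarization[of a b] by simp
    also have "(1/2 * (t + s))\<^sup>2 + - (1/2 * (t + - s))\<^sup>2 = t * s"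
      by (simp add: power2_eq_square field_simps)
    finally show ?thesis .
  qed
  define \<phi> where "\<phi> a = (SOME t. near a t)" for a
  have \<phi>: "near a (\<phi> a)" for a
    unfolding \<phi>_def using ex by (rule someI_ex)
  show ?thesis
  proof
    show "real_hom \<phi>"
      unfolding real_hom_def
      by (intro conjI allI uniq[OF \<phi> const] uniq[OF \<phi> add] uniq[OF \<phi> mult] \<phi>)
    show "\<phi> a \<ge> 0" if "a \<in> Q" for a
      using nonneg[OF \<phi> that] .
  qed
qed

text \<open>Bounds persist in larger modules, so a maximal proper module above \<open>M\<close> is
  both total and archimedean and carries a character.\<close>

lemma archimedean_real_hom_exists:
  assumes "quadratic_module M" "- 1 \<notin> M" "bdd M = UNIV"
  obtains \<phi> where "real_hom \<phi>" "\<And>a. a \<in> M \<Longrightarrow> \<phi> a \<ge> 0"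
proof -
  obtain Q where Q: "quadratic_module Q" "- 1 \<notin> Q" "M \<subseteq> Q"
    "\<And>Q'. quadratic_module Q' \<Longrightarrow> Q \<subseteq> Q' \<Longrightarrow> - 1 \<notin> Q' \<Longrightarrow> Q' = Q"
    using maximal_quadratic_module[OF assms(1,2)] by metis
  have "bdd Q = UNIV"
    using assms(3) Q(3) by (force simp: bdd_def set_eq_iff)
  then show ?thesis
    using total_quadratic_module_real_hom[OF Q(1,2)] maximal_quadratic_module_total[OF Q(1,2,4)] Q(3) that
    by (metis subsetD)
qed

text \<open>Without a positive functional on \<open>M - \<Sigma>A\<^sup>2 g\<close> there is a sum of squares \<open>s\<close> with \<open>s g - 1 \<in> M\<close>.
  Such an \<open>s\<close> lets one lower \<open>r\<close> in \<open>g + r \<in> M\<close> by the fixed amount \<open>1 / k\<^sup>2\<close>, for \<open>k\<close> large.\<close>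
lemma archimedean_positivstellensatz_strict:
  assumes M: "quadratic_module M" "bdd M = UNIV"
    and pos: "\<And>\<phi>. real_hom \<phi> \<Longrightarrow> (\<And>a. a \<in> M \<Longrightarrow> \<phi> a \<ge> 0) \<Longrightarrow> \<phi> g > 0"
  shows "g \<in> M"
proof -
  note qm = quadratic_moduleD[OF M(1)]
  \<comment> \<open>A character nonnegative on \<open>N\<close> would make \<open>g\<close>
    nonpositive, against \<open>pos\<close>. Hence \<open>N\<close> contains -1, which produces the
    sum of squares \<open>s\<close>.\<close>
  define N where "N = {q + s * (- g) | q s. q \<in> M \<and> s \<in> qmod_gen {}}"
  have N: "quadratic_module N" "M \<subseteq> N" "- g \<in> N"
    unfolding N_def by (fact quadratic_module_adjoin[OF M(1)])+
  have "bdd N = UNIV"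
    using M(2) N(2) by (force simp: bdd_def set_eq_iff)
  have "- 1 \<in> N"
  proof (rule ccontr)
    assume "- 1 \<notin> N"
    then obtain \<phi> where \<phi>: "real_hom \<phi>" "\<And>a. a \<in> N \<Longrightarrow> \<phi> a \<ge> 0"
      using archimedean_real_hom_exists[OF N(1) _ \<open>bdd N = UNIV\<close>] by blast
    have "\<phi> g > 0"
      using pos[OF \<phi>(1)] \<phi>(2) N(2) by blast
    then show False
      using \<phi>(2)[OF N(3)] real_homD(6)[OF \<phi>(1), of g] by simp
  qed
  then obtain q s where qs: "- 1 = q + s * (- g)" "q \<in> M" "s \<in> qmod_gen {}"
    by (auto simp: N_def)
  have "s * g - 1 = q"
    using arg_cong[OF qs(1), of "\<lambda>x. x + s * g"] by simp
  with qs(2) have sg: "s * g - 1 \<in> M"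
    by simp
  obtain r1 r2 where r1: "c r1 - s \<in> M" and r2: "c r2 - s\<^sup>2 * g \<in> M"
    using M(2) unfolding bdd_def by blast
  \<comment> \<open>Chosen independently of \<open>r\<close>, so that 2 k - s and 2 k - 1 - s^2 g
    both lie in \<open>M\<close>.\<close>
  define k where "k = max 1 (max r1 ((r2 + 1) / 2))"
  have k: "k \<ge> 1" "r1 \<le> 2 * k" "r2 \<le> 2 * k - 1"
    by (auto simp: k_def field_simps max_def)
  have k1: "c (2 * k) - s \<in> M" "c (2 * k - 1) - s\<^sup>2 * g \<in> M"
    using qm_mono_const[OF M(1), of r1 "- s" "2 * k"] qm_mono_const[OF M(1), of r2 "- (s\<^sup>2 * g)" "2 * k - 1"]
      r1 r2 k by auto
  have step: "c (r - 1 / k\<^sup>2) + g \<in> M" if r: "c r + g \<in> M" "r \<ge> 0" for r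
  proof -
    have "(c k - s)\<^sup>2 * (c r + g) \<in> M"
      using qm r by blast
    moreover have "c (2 * k) * (s * g - 1) \<in> M"
      using qm_scale[OF M(1) sg] k by simp
    moreover have "c r * (s * (c (2 * k) - s)) \<in> M"
      using qm_scale[OF M(1) quadratic_module_sos_mult[OF M(1) k1(1) qs(3)]] r by simp
    \<comment> \<open>The four summands are arranged so that every term containing \<open>s\<close>
      cancels, leaving k^2 (r + g) - 1.\<close>
    ultimately have "(c k - s)\<^sup>2 * (c r + g) + c (2 * k) * (s * g - 1) + c r * (s * (c (2 * k) - s))
       + (c (2 * k - 1) - s\<^sup>2 * g) \<in> M"
      using k1(2) qm(2) by blast
    moreover have "c 2 = 1 + 1"
      using c_add[of 1 1] by (simp add: c_one)
    moreover have id: "(K - s)\<^sup>2 * (R + g) + ((1 + 1) * K) * (s * g - 1) + R * (s * ((1 + 1) * K - s))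
       + ((1 + 1) * K - 1 - s\<^sup>2 * g) = K\<^sup>2 * R + K\<^sup>2 * g - 1" for K R :: 'a
      by (simp add: power2_eq_square algebra_simps)
    ultimately have *: "c (k\<^sup>2) * c r + c (k\<^sup>2) * g - 1 \<in> M"
      by (simp only: c_diff c_one c_mult c_power id)
    have "c (1 / k\<^sup>2) * c (k\<^sup>2) = 1"
      using k by (simp add: c_one flip: c_mult)
    then have "c (1 / k\<^sup>2) * (c (k\<^sup>2) * c r + c (k\<^sup>2) * g - 1) = c r + g - c (1 / k\<^sup>2)"
      by (simp add: distrib_left right_diff_distrib flip: mult.assoc)
    then show ?thesis
      using qm_scale[OF M(1) *, of "1 / k\<^sup>2"] by (simp add: c_diff algebra_simps)
  qed
  obtain r0 where r0: "r0 > 0" "c r0 + g \<in> M"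
    using bddE[OF M(1), of g] M(2) by auto
  \<comment> \<open>The second alternative absorbs the indices at which the constant has become
    negative: there \<open>g\<close> is already a member.\<close>
  have iter: "c (r0 - real n / k\<^sup>2) + g \<in> M \<or> g \<in> M" for n
  proof (induction n)
    case 0
    then show ?case using r0 by simp
  next
    case (Suc n)
    show ?case
    proof (cases "r0 - real n / k\<^sup>2 \<ge> 0")
      case True
      then show ?thesis
        using Suc step[of "r0 - real n / k\<^sup>2"] by (auto simp: add_divide_distrib algebra_simps)
    next
      case False
      then show ?thesis
        using Suc qm_mono_const[OF M(1), of "r0 - real n / k\<^sup>2" g 0] by (auto simp: c_zero)
    qed
  qed
  obtain n where "r0 * k\<^sup>2 \<le> real n"
    using real_arch_simple by blast
  then have "r0 - real n / k\<^sup>2 \<le> 0"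
    using k by (simp add: field_simps)
  then show ?thesis
    using iter[of n] qm_mono_const[OF M(1), of "r0 - real n / k\<^sup>2" g 0] by (auto simp: c_zero)
qed

text \<open>If \<open>f\<close> is nonnegative under each such character, then
  \<open>f + c \<epsilon>\<close> is strictly positive there.\<close>

theorem archimedean_positivstellensatz:
  assumes M: "quadratic_module M" "bdd M = UNIV"
    and nonneg: "\<And>\<phi>. real_hom \<phi> \<Longrightarrow> (\<And>a. a \<in> M \<Longrightarrow> \<phi> a \<ge> 0) \<Longrightarrow> \<phi> f \<ge> 0"
    and "\<epsilon> > 0"
  shows "f + c \<epsilon> \<in> M"
  using archimedean_positivstellensatz_strict[OF M, of "f + c \<epsilon>"] nonneg \<open>\<epsilon> > 0\<close>
  by (simp add: real_homD add_nonneg_pos)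

end

section \<open>Evaluation homomorphisms\<close>

lemma poly_mapping_sum_single:
  "f = (\<Sum>k\<in>Poly_Mapping.keys f. Poly_Mapping.single k (Poly_Mapping.lookup f k))"
  by (rule poly_mapping_eqI)
    (simp add: lookup_sum lookup_single when_def not_in_keys_iff_lookup_eq_zero cong: if_cong)

text \<open>Identities that are additive in an argument need only be checked on single terms; the
  summands may share keys.\<close>

lemma poly_mapping_single_induct [case_names zero single add]:
  assumes "P 0" "\<And>k a. P (Poly_Mapping.single k a)" "\<And>f g. P f \<Longrightarrow> P g \<Longrightarrow> P (f + g)"
  shows "P (f :: 'k \<Rightarrow>\<^sub>0 'b::comm_monoid_add)"
proof -
  have "P (\<Sum>k\<in>I. Poly_Mapping.single k (Poly_Mapping.lookup f k))" for I
    by (induction I rule: infinite_finite_induct) (auto intro: assms)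
  then show ?thesis
    by (subst poly_mapping_sum_single)
qed

text \<open>Coefficients are evaluated by \<open>\<psi>\<close> and monomials by
  \<open>\<omega>\<close>. The separate \<open>\<psi>\<close> is what lets the mixed ring, whose
  coefficients are polynomials in the moments, be treated like the other two rings.\<close>

definition poly_eval :: "('b \<Rightarrow> real) \<Rightarrow> ('k \<Rightarrow> real) \<Rightarrow> ('k \<Rightarrow>\<^sub>0 'b::zero) \<Rightarrow> real" where
  "poly_eval \<psi> \<omega> f = (\<Sum>k\<in>Poly_Mapping.keys f. \<psi> (Poly_Mapping.lookup f k) * \<omega> k)"

lemma poly_eval_superset:
  assumes "finite A" "Poly_Mapping.keys f \<subseteq> A" "\<psi> 0 = 0"
  shows "poly_eval \<psi> \<omega> f = (\<Sum>k\<in>A. \<psi> (Poly_Mapping.lookup f k) * \<omega> k)"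
  unfolding poly_eval_def
  by (rule sum.mono_neutral_left) (use assms in \<open>auto simp: not_in_keys_iff_lookup_eq_zero\<close>)

lemma poly_eval_single:
  "\<psi> 0 = 0 \<Longrightarrow> poly_eval \<psi> \<omega> (Poly_Mapping.single k a) = \<psi> a * \<omega> k"
  by (subst poly_eval_superset[of "{k}"]) auto

lemma poly_eval_zero: "poly_eval \<psi> \<omega> 0 = 0"
  by (simp add: poly_eval_def)

lemma poly_eval_add:
  fixes f g :: "'k \<Rightarrow>\<^sub>0 'b::comm_monoid_add"
  assumes "\<psi> 0 = 0" "\<And>a b. \<psi> (a + b) = \<psi> a + \<psi> b"
  shows "poly_eval \<psi> \<omega> (f + g) = poly_eval \<psi> \<omega> f + poly_eval \<psi> \<omega> g"
proof -
  let ?A = "Poly_Mapping.keys f \<union> Poly_Mapping.keys g"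
  have "Poly_Mapping.keys (f + g) \<subseteq> ?A"
    by (rule keys_add)
  then show ?thesis
    using assms
    by (simp add: poly_eval_superset[of ?A] lookup_add distrib_right sum.distrib)
qed

lemma poly_eval_mult:
  fixes f g :: "'k::comm_monoid_add \<Rightarrow>\<^sub>0 'b::comm_semiring_0"
  assumes \<psi>: "\<psi> 0 = 0" "\<And>a b. \<psi> (a + b) = \<psi> a + \<psi> b" "\<And>a b. \<psi> (a * b) = \<psi> a * \<psi> b"
    and \<omega>: "\<And>k l. \<omega> (k + l) = \<omega> k * \<omega> l"
  shows "poly_eval \<psi> \<omega> (f * g) = poly_eval \<psi> \<omega> f * poly_eval \<psi> \<omega> g"
proof (induction f rule: poly_mapping_single_induct)
  case (single k a)
  show ?case
    by (induction g rule: poly_mapping_single_induct)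
      (simp_all add: \<psi> \<omega> poly_eval_zero poly_eval_single poly_eval_add mult_single distrib_left)
qed (simp_all add: poly_eval_zero poly_eval_add \<psi> distrib_right)

definition monomial_eval :: "('g \<Rightarrow> real) \<Rightarrow> ('g \<Rightarrow>\<^sub>0 nat) \<Rightarrow> real" where
  "monomial_eval v \<alpha> = (\<Prod>i\<in>Poly_Mapping.keys \<alpha>. v i ^ Poly_Mapping.lookup \<alpha> i)"

lemma monomial_eval_superset:
  assumes "finite A" "Poly_Mapping.keys \<alpha> \<subseteq> A"
  shows "monomial_eval v \<alpha> = (\<Prod>i\<in>A. v i ^ Poly_Mapping.lookup \<alpha> i)"
  unfolding monomial_eval_def
  by (rule prod.mono_neutral_left) (use assms in \<open>auto simp: not_in_keys_iff_lookup_eq_zero\<close>)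

lemma monomial_eval_zero: "monomial_eval v 0 = 1"
  by (simp add: monomial_eval_def)

lemma monomial_eval_add: "monomial_eval v (\<alpha> + \<beta>) = monomial_eval v \<alpha> * monomial_eval v \<beta>"
proof -
  let ?A = "Poly_Mapping.keys \<alpha> \<union> Poly_Mapping.keys \<beta>"
  have "Poly_Mapping.keys (\<alpha> + \<beta>) \<subseteq> ?A"
    by (rule keys_add)
  then show ?thesis
    by (simp add: monomial_eval_superset[of ?A] lookup_add power_add prod.distrib)
qed

lemma monomial_eval_single_one: "monomial_eval v (Poly_Mapping.single i 1) = v i"
  by (simp add: monomial_eval_def)

interpretation pm: real_scalars "Poly_Mapping.single 0 :: real \<Rightarrow> 'k::comm_monoid_add \<Rightarrow>\<^sub>0 real"
  by standard (simp_all add: single_add mult_single)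

text \<open>Through this factorization, characters and bounds pass from indeterminates to
  monomials.\<close>

lemma monomial_as_product:
  "Poly_Mapping.single \<beta> (1::'b::comm_semiring_1) =
    (\<Prod>g\<in>Poly_Mapping.keys \<beta>. Poly_Mapping.single (Poly_Mapping.single g 1) 1 ^ Poly_Mapping.lookup \<beta> g)"
  for \<beta> :: "'g \<Rightarrow>\<^sub>0 nat"
proof -
  have pow: "Poly_Mapping.single (Poly_Mapping.single g 1) (1::'b) ^ n = Poly_Mapping.single (Poly_Mapping.single g n) 1"
    for g :: 'g and n :: nat
    by (induction n) (simp_all add: mult_single flip: single_add)
  have sum: "(\<Prod>g\<in>I. Poly_Mapping.single (f g) (1::'b)) = Poly_Mapping.single (sum f I) 1"
    for I and f :: "'g \<Rightarrow> 'g \<Rightarrow>\<^sub>0 nat"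
    by (induction I rule: infinite_finite_induct) (simp_all add: mult_single)
  show ?thesis
    unfolding pow sum by (simp flip: poly_mapping_sum_single)
qed

lemma single_eq_scalar_mult:
  "Poly_Mapping.single \<alpha> a = Poly_Mapping.single 0 a * Poly_Mapping.single (\<alpha> :: 'k::comm_monoid_add) (1::'b::comm_semiring_1)"
  by (simp add: mult_single)

lemma real_hom_poly_eval:
  "pm.real_hom (poly_eval (\<lambda>a. a) (monomial_eval v))"
  by (simp add: pm.real_hom_def poly_eval_single poly_eval_add poly_eval_mult
      monomial_eval_zero monomial_eval_add)

text \<open>A character is multiplicative on the factorization of each monomial into indeterminates,
  so its values there determine it. This covers infinitely many indeterminates, since each
  polynomial involves finitely many.\<close>

lemma real_hom_eq_poly_eval:
  assumes "pm.real_hom \<phi>"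
  shows "\<phi> p = poly_eval (\<lambda>a. a) (monomial_eval (\<lambda>g. \<phi> (Poly_Mapping.single (Poly_Mapping.single g 1) 1))) p"
proof (induction p rule: poly_mapping_single_induct)
  case (single \<beta> a)
  have "\<phi> (Poly_Mapping.single \<beta> 1)
      = monomial_eval (\<lambda>g. \<phi> (Poly_Mapping.single (Poly_Mapping.single g 1) 1)) \<beta>"
    by (subst monomial_as_product)
      (simp add: monomial_eval_def pm.real_hom_prod[OF assms] pm.real_homD[OF assms])
  then show ?case
    by (subst single_eq_scalar_mult) (simp add: pm.real_homD[OF assms] poly_eval_single)
qed (simp_all add: pm.real_homD[OF assms] poly_eval_zero poly_eval_add)

section \<open>Evaluation at points and measures\<close>

lemma eval_x_eq_poly_eval: "eval_x p X = poly_eval (\<lambda>a. a) (\<lambda>\<alpha>. xmono \<alpha> X) p"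
  by (simp add: eval_x_def poly_eval_def)

lemma xmono_eq_monomial_eval: "xmono \<alpha> X = monomial_eval (\<lambda>i. X $ i) \<alpha>"
  by (simp add: xmono_def monomial_eval_superset[of UNIV])

lemma eval_m_eq_poly_eval:
  "eval_m \<mu> g = poly_eval (\<lambda>a. a) (monomial_eval (\<lambda>\<gamma>. moment \<mu> (Rep_midx \<gamma>))) g"
  by (simp add: eval_m_def poly_eval_def monomial_eval_def)

lemma eval_mx_eq_poly_eval: "eval_mx \<mu> X f = poly_eval (eval_m \<mu>) (\<lambda>\<alpha>. xmono \<alpha> X) f"
  by (simp add: eval_mx_def poly_eval_def)

lemma real_hom_eval_x: "pm.real_hom (\<lambda>p. eval_x p X)"
  unfolding eval_x_eq_poly_eval xmono_eq_monomial_eval by (rule real_hom_poly_eval)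

lemma real_hom_eval_m: "pm.real_hom (eval_m \<mu>)"
  unfolding eval_m_eq_poly_eval[abs_def] by (rule real_hom_poly_eval)

interpretation mx: real_scalars mxconst
  by standard (simp_all add: mxconst_def mconst_def single_add mult_single)

lemma real_hom_eval_mx: "mx.real_hom (eval_mx \<mu> X)"
  by (simp add: mx.real_hom_def eval_mx_eq_poly_eval[abs_def] poly_eval_single poly_eval_add poly_eval_mult
      pm.real_homD[OF real_hom_eval_m] xmono_eq_monomial_eval monomial_eval_zero monomial_eval_add
      mxconst_def mconst_def)

lemma eval_x_single: "eval_x (Poly_Mapping.single \<alpha> a) X = a * xmono \<alpha> X"
  by (simp add: eval_x_eq_poly_eval poly_eval_single)

lemma xmono_zero: "xmono 0 X = 1"
  by (simp add: xmono_eq_monomial_eval monomial_eval_zero)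

lemma real_hom_eq_eval_x:
  assumes "pm.real_hom \<phi>"
  shows "\<phi> p = eval_x p (\<chi> i. \<phi> (Poly_Mapping.single (Poly_Mapping.single i 1) 1))"
  by (subst real_hom_eq_poly_eval[OF assms]) (simp add: eval_x_eq_poly_eval xmono_eq_monomial_eval poly_eval_def monomial_eval_def)

lemma mvar_Rep_midx: "mvar (Rep_midx \<gamma>) = Poly_Mapping.single (Poly_Mapping.single \<gamma> 1) 1"
  using Rep_midx[of \<gamma>] by (simp add: mvar_def Rep_midx_inverse)

lemma mvar_zero: "mvar 0 = 1"
  by (simp add: mvar_def)

lemma mvar_nonzero:
  assumes "\<alpha> \<noteq> 0"
  shows "mvar \<alpha> = Poly_Mapping.single (Poly_Mapping.single (Abs_midx \<alpha>) 1) 1" "Rep_midx (Abs_midx \<alpha>) = \<alpha>"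
  using assms by (simp_all add: mvar_def Abs_midx_inverse)

text \<open>The \<open>mvar\<close> of nonzero multi-indices are the indeterminates of the moment
  ring, so matching moments fixes the character.\<close>

lemma real_hom_eq_eval_m:
  assumes "pm.real_hom \<phi>" "\<And>\<alpha>. \<phi> (mvar \<alpha>) = moment \<mu> \<alpha>"
  shows "\<phi> g = eval_m \<mu> g"
  by (subst real_hom_eq_poly_eval[OF assms(1)])
    (simp add: eval_m_eq_poly_eval flip: mvar_Rep_midx assms(2) del: One_nat_def)

text \<open>Total mass 1 enters at index 0, where \<open>mvar\<close> is the constant 1 and not an
  indeterminate.\<close>

lemma eval_m_mvar:
  assumes "prob_space \<mu>"
  shows "eval_m \<mu> (mvar \<alpha>) = moment \<mu> \<alpha>"
proof (cases "\<alpha> = 0")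
  case True
  then show ?thesis
    using prob_space.prob_space[OF assms]
    by (simp add: mvar_zero pm.real_homD[OF real_hom_eval_m] moment_def xmono_zero)
next
  case False
  then show ?thesis
    by (simp add: mvar_nonzero eval_m_eq_poly_eval poly_eval_single monomial_eval_single_one del: One_nat_def)
qed

section \<open>Embeddings into the mixed ring\<close>

lemma lookup_X_to_MX: "Poly_Mapping.lookup (X_to_MX p) \<alpha> = mconst (Poly_Mapping.lookup p \<alpha>)"
  unfolding X_to_MX_def by transfer (simp add: when_def mconst_def)

lemma X_to_MX_single: "X_to_MX (Poly_Mapping.single \<alpha> a) = Poly_Mapping.single \<alpha> (mconst a)"
  by (simp add: X_to_MX_def mconst_def)

lemma X_to_MX_zero: "X_to_MX 0 = 0"
  by (simp add: poly_mapping_eq_iff fun_eq_iff lookup_X_to_MX mconst_def)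

lemma X_to_MX_add: "X_to_MX (p + q) = X_to_MX p + X_to_MX q"
  by (simp add: poly_mapping_eq_iff fun_eq_iff lookup_X_to_MX lookup_add mconst_def single_add)

lemma X_to_MX_mult: "X_to_MX (p * q) = X_to_MX p * X_to_MX q"
proof (induction p rule: poly_mapping_single_induct)
  case (single k a)
  show ?case
    by (induction q rule: poly_mapping_single_induct)
      (simp_all add: X_to_MX_zero X_to_MX_single X_to_MX_add mult_single distrib_left mconst_def)
qed (simp_all add: X_to_MX_zero X_to_MX_add distrib_right)

lemma X_to_MX_const: "X_to_MX (Poly_Mapping.single 0 r) = mxconst r"
  by (simp add: X_to_MX_single mxconst_def)

lemma X_to_MX_one: "X_to_MX 1 = 1"
  using X_to_MX_const[of 1] by (simp add: mx.c_one)

lemma X_to_MX_minus: "X_to_MX (- p) = - X_to_MX p"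
  using X_to_MX_add[of p "- p"] by (simp add: X_to_MX_zero add_eq_0_iff)

lemma M_to_MX_simps:
  "M_to_MX (mconst r) = mxconst r" "M_to_MX (g + h) = M_to_MX g + M_to_MX h"
  "M_to_MX (g * h) = M_to_MX g * M_to_MX h" "M_to_MX 0 = 0" "M_to_MX 1 = 1"
  by (simp_all add: M_to_MX_def mxconst_def single_add mult_single)

lemma eval_mx_X_to_MX: "eval_mx \<mu> X (X_to_MX p) = eval_x p X"
proof -
  have "pm.real_hom (\<lambda>p. eval_mx \<mu> X (X_to_MX p))"
    by (simp add: pm.real_hom_def X_to_MX_const X_to_MX_add X_to_MX_mult mx.real_homD[OF real_hom_eval_mx])
  from real_hom_eq_eval_x[OF this, of p] show ?thesis
    by (simp add: X_to_MX_single eval_mx_eq_poly_eval poly_eval_single pm.real_homD[OF real_hom_eval_m]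
        xmono_eq_monomial_eval[abs_def] monomial_eval_single_one mconst_def del: One_nat_def)
qed

lemma eval_mx_M_to_MX: "eval_mx \<mu> X (M_to_MX g) = eval_m \<mu> g"
  by (simp add: M_to_MX_def eval_mx_eq_poly_eval poly_eval_single pm.real_homD[OF real_hom_eval_m] xmono_zero)

text \<open>The tensor product structure in concrete form: it reduces characters and bounds on the
  mixed ring to the two embedded rings.\<close>

lemma mx_decompose:
  "f = (\<Sum>\<alpha>\<in>Poly_Mapping.keys f. M_to_MX (Poly_Mapping.lookup f \<alpha>) * X_to_MX (Poly_Mapping.single \<alpha> 1))"
  by (subst poly_mapping_sum_single)
    (simp add: M_to_MX_def X_to_MX_single mult_single mconst_def)

lemma real_hom_M_to_MX:
  assumes "mx.real_hom \<phi>"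
  shows "pm.real_hom (\<lambda>g. \<phi> (M_to_MX g))"
  unfolding pm.real_hom_def
  using mx.real_homD[OF assms] by (simp add: M_to_MX_simps flip: mconst_def)

lemma real_hom_X_to_MX:
  assumes "mx.real_hom \<phi>"
  shows "pm.real_hom (\<lambda>p. \<phi> (X_to_MX p))"
  unfolding pm.real_hom_def
  using mx.real_homD[OF assms] by (simp add: X_to_MX_const X_to_MX_add X_to_MX_mult)

lemma real_hom_eq_eval_mx:
  assumes \<phi>: "mx.real_hom \<phi>"
    and "\<And>g. \<phi> (M_to_MX g) = eval_m \<mu> g" "\<And>p. \<phi> (X_to_MX p) = eval_x p X"
  shows "\<phi> f = eval_mx \<mu> X f"
  by (subst (1 2) mx_decompose)
    (simp add: mx.real_hom_sum[OF \<phi>] mx.real_hom_sum[OF real_hom_eval_mx] mx.real_homD[OF \<phi>]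
      mx.real_homD[OF real_hom_eval_mx] assms(2,3) eval_mx_M_to_MX eval_mx_X_to_MX)

section \<open>The formal moment map\<close>

lemma mom_map_superset:
  assumes "finite A" "Poly_Mapping.keys f \<subseteq> A"
  shows "mom_map f = (\<Sum>\<alpha>\<in>A. Poly_Mapping.lookup f \<alpha> * mvar \<alpha>)"
  unfolding mom_map_def
  by (rule sum.mono_neutral_left) (use assms in \<open>auto simp: not_in_keys_iff_lookup_eq_zero\<close>)

lemma mom_map_add: "mom_map (f + g) = mom_map f + mom_map g"
proof -
  let ?A = "Poly_Mapping.keys f \<union> Poly_Mapping.keys g"
  have "Poly_Mapping.keys (f + g) \<subseteq> ?A"
    by (rule keys_add)
  then show ?thesis
    by (simp add: mom_map_superset[of ?A] lookup_add distrib_right sum.distrib)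
qed

lemma mom_map_single: "mom_map (Poly_Mapping.single \<alpha> g) = g * mvar \<alpha>"
  by (subst mom_map_superset[of "{\<alpha>}"]) auto

lemma mom_map_zero: "mom_map 0 = 0"
  by (simp add: mom_map_def)

lemma mom_map_minus: "mom_map (- f) = - mom_map f"
  using mom_map_add[of f "- f"] by (simp add: mom_map_zero add_eq_0_iff)

lemma continuous_on_xmono: "continuous_on UNIV (\<lambda>X. xmono \<alpha> (X :: real ^ 'n::finite))"
  unfolding xmono_def by (intro continuous_intros)

lemma continuous_on_eval_x: "continuous_on UNIV (\<lambda>X. eval_x p (X :: real ^ 'n::finite))"
  unfolding eval_x_def by (intro continuous_intros continuous_on_xmono)

lemma countable_multi_indices: "countable (UNIV :: ('n::finite \<Rightarrow>\<^sub>0 nat) set)"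
proof -
  have "inj (Poly_Mapping.lookup :: ('n \<Rightarrow>\<^sub>0 nat) \<Rightarrow> 'n \<Rightarrow> nat)"
    by (auto intro!: injI poly_mapping_eqI)
  then show ?thesis
    by (rule countable_image_inj_on[rotated]) (rule countableI_type)
qed

section \<open>The moment problem on compact sets\<close>

text \<open>By \<open>sep\<close> no affine functional separates \<open>v\<close> from the points
  given by \<open>K\<close>. So a next point can always be chosen whose error has inner product at
  most 1 with the accumulated error. The squared error then grows linearly in \<open>N\<close>,
  while averaging divides it by N^2.\<close>

lemma greedy_average:
  fixes e :: "'i \<Rightarrow> 'a \<Rightarrow> real" and v :: "'i \<Rightarrow> real"
  assumes "finite A" "\<epsilon> > 0"
    and bound: "\<And>i x. i \<in> A \<Longrightarrow> x \<in> K \<Longrightarrow> \<bar>e i x\<bar> \<le> B i"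
    and sep: "\<And>w b. (\<And>x. x \<in> K \<Longrightarrow> b \<le> (\<Sum>i\<in>A. w i * e i x)) \<Longrightarrow> b \<le> (\<Sum>i\<in>A. w i * v i)"
  obtains N and x :: "nat \<Rightarrow> 'a" where "N > 0" "\<And>j. x j \<in> K"
    "\<And>i. i \<in> A \<Longrightarrow> \<bar>(\<Sum>j<N. e i (x j)) / real N - v i\<bar> < \<epsilon>"
proof -
  define C where "C = (\<Sum>i\<in>A. (\<bar>v i\<bar> + B i)\<^sup>2)"
  have C: "(\<Sum>i\<in>A. (v i - e i x)\<^sup>2) \<le> C" if "x \<in> K" for x
    unfolding C_def
  proof (rule sum_mono)
    fix i assume "i \<in> A"
    then have "\<bar>v i - e i x\<bar> \<le> \<bar>\<bar>v i\<bar> + B i\<bar>"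
      using bound[OF _ that, of i] by linarith
    then show "(v i - e i x)\<^sup>2 \<le> (\<bar>v i\<bar> + B i)\<^sup>2"
      by (simp only: abs_le_square_iff)
  qed
  have "C \<ge> 0"
    unfolding C_def by (intro sum_nonneg) auto
  \<comment> \<open>Otherwise the weights \<open>- S\<close> separate \<open>v\<close> from
    \<open>K\<close>. The slack 1 avoids asking for an attained minimum on \<open>K\<close>.\<close>
  have step: "\<exists>y\<in>K. (\<Sum>i\<in>A. S i * (v i - e i y)) \<le> 1" for S
  proof (rule ccontr)
    assume "\<not> ?thesis"
    then have *: "1 < (\<Sum>i\<in>A. S i * (v i - e i y))" if "y \<in> K" for y
      using that by (meson not_le)
    have "1 - (\<Sum>i\<in>A. S i * v i) \<le> (\<Sum>i\<in>A. - S i * e i y)" if "y \<in> K" for y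
      using *[OF that] by (simp add: right_diff_distrib sum_subtractf sum_negf)
    from sep[OF this] show False
      by (simp add: sum_negf)
  qed
  have ex: "\<exists>x. (\<forall>j. x j \<in> K) \<and> (\<Sum>i\<in>A. (\<Sum>j<N. v i - e i (x j))\<^sup>2) \<le> (C + 2) * real N" for N
  proof (induction N)
    case 0
    then show ?case
      \<comment> \<open>A point of \<open>K\<close> for the initial sequence: \<open>step\<close> at
        zero weights provides one.\<close>
      using step[of "\<lambda>_. 0"] by auto
  next
    case (Suc N)
    then obtain x where x: "\<And>j. x j \<in> K" "(\<Sum>i\<in>A. (\<Sum>j<N. v i - e i (x j))\<^sup>2) \<le> (C + 2) * real N"
      by blast
    define S where "S i = (\<Sum>j<N. v i - e i (x j))" for i
    obtain y where y: "y \<in> K" "(\<Sum>i\<in>A. S i * (v i - e i y)) \<le> 1"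
      using step by blast
    have "(\<Sum>j<Suc N. v i - e i ((x(N := y)) j)) = S i + (v i - e i y)" for i
      by (simp add: S_def)
    then have "(\<Sum>i\<in>A. (\<Sum>j<Suc N. v i - e i ((x(N := y)) j))\<^sup>2) = (\<Sum>i\<in>A. (S i + (v i - e i y))\<^sup>2)"
      by simp
    also have "\<dots> = (\<Sum>i\<in>A. (S i)\<^sup>2) + 2 * (\<Sum>i\<in>A. S i * (v i - e i y)) + (\<Sum>i\<in>A. (v i - e i y)\<^sup>2)"
      by (simp add: power2_sum sum.distrib sum_distrib_left mult.assoc)
    also have "\<dots> \<le> (C + 2) * real N + 2 * 1 + C"
      using x(2) y(2) C[OF y(1)] by (simp add: S_def)
    finally have "(\<Sum>i\<in>A. (\<Sum>j<Suc N. v i - e i ((x(N := y)) j))\<^sup>2) \<le> (C + 2) * real (Suc N)"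
      by (simp add: algebra_simps)
    then show ?case
      using x(1) y(1) by (intro exI[of _ "x(N := y)"]) auto
  qed
  obtain N where N: "(C + 2) / \<epsilon>\<^sup>2 < real N"
    using reals_Archimedean2 by blast
  have "(C + 2) / \<epsilon>\<^sup>2 > 0"
    using \<open>C \<ge> 0\<close> \<open>\<epsilon> > 0\<close> by (intro divide_pos_pos) auto
  then have "N > 0"
    using N by (cases N) auto
  have "C + 2 < \<epsilon>\<^sup>2 * real N"
    using N \<open>\<epsilon> > 0\<close> by (simp add: field_simps)
  then have "(C + 2) * real N < (\<epsilon>\<^sup>2 * real N) * real N"
    using \<open>N > 0\<close> by (intro mult_strict_right_mono) auto
  then have CN: "(C + 2) * real N < (\<epsilon> * real N)\<^sup>2"
    by (simp add: power2_eq_square mult_ac)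
  obtain x where x: "\<And>j. x j \<in> K" "(\<Sum>i\<in>A. (\<Sum>j<N. v i - e i (x j))\<^sup>2) \<le> (C + 2) * real N"
    using ex by blast
  show ?thesis
  proof
    fix i assume "i \<in> A"
    then have "(\<Sum>j<N. v i - e i (x j))\<^sup>2 \<le> (\<Sum>i\<in>A. (\<Sum>j<N. v i - e i (x j))\<^sup>2)"
      by (intro member_le_sum) (auto simp: \<open>finite A\<close>)
    then have "\<bar>\<Sum>j<N. v i - e i (x j)\<bar>\<^sup>2 < (\<epsilon> * real N)\<^sup>2"
      unfolding power2_abs using x(2) CN by linarith
    then have "\<bar>\<Sum>j<N. v i - e i (x j)\<bar> < \<epsilon> * real N"
      by (rule power2_less_imp_less) (use \<open>\<epsilon> > 0\<close> in auto)
    then have "\<bar>\<Sum>j<N. v i - e i (x j)\<bar> / real N < \<epsilon>"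
      using \<open>N > 0\<close> by (simp add: pos_divide_less_eq)
    moreover have "(\<Sum>j<N. e i (x j)) / real N - v i = - (\<Sum>j<N. v i - e i (x j)) / real N"
      using \<open>N > 0\<close> by (simp add: sum_subtractf diff_divide_distrib)
    ultimately show "\<bar>(\<Sum>j<N. e i (x j)) / real N - v i\<bar> < \<epsilon>"
      by (simp only: abs_divide abs_minus_cancel abs_of_nat)
  qed (rule \<open>N > 0\<close> x(1))+
qed

section \<open>Coding compact sets in the real line\<close>

text \<open>At the first differing digit \<open>l\<close> the terms differ by 3^-(l+1), and the
  remaining tail offsets at most half of that. In base 2 the tail could offset all of it.\<close>

lemma ternary_digits_agree:
  fixes a b :: "nat \<Rightarrow> real"
  assumes ab: "\<And>k. a k \<in> {0, 1}" "\<And>k. b k \<in> {0, 1}"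
    and close: "\<bar>suminf (\<lambda>k. a k / 3 ^ Suc k) - suminf (\<lambda>k. b k / 3 ^ Suc k)\<bar> < 1 / (2 * 3 ^ Suc m)"
    and "k \<le> m"
  shows "a k = b k"
proof (rule ccontr)
  assume "a k \<noteq> b k"
  define l where "l = (LEAST k. a k \<noteq> b k)"
  have "a l \<noteq> b l"
    unfolding l_def by (rule LeastI[of "\<lambda>k. a k \<noteq> b k", OF \<open>a k \<noteq> b k\<close>])
  moreover have "a i = b i" if "i < l" for i
    using not_less_Least[of i "\<lambda>k. a k \<noteq> b k"] that by (simp add: l_def)
  moreover have "l \<le> m"
    using Least_le[of "\<lambda>k. a k \<noteq> b k", OF \<open>a k \<noteq> b k\<close>] \<open>k \<le> m\<close> by (simp add: l_def)
  ultimately have l: "a l \<noteq> b l" "\<And>i. i < l \<Longrightarrow> a i = b i" "l \<le> m"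
    by blast+
  define d where "d k = (a k - b k) / 3 ^ Suc k" for k
  have geo: "(\<lambda>k. 1 / 3 ^ Suc (k + n)) sums (1 / (2 * 3 ^ n) :: real)" for n
    using sums_mult[OF geometric_sums[of "1/3::real"], of "1 / 3 ^ Suc n"]
    by (simp add: power_add power_one_over field_simps)
  have summ: "summable (\<lambda>k. c k / 3 ^ Suc k)" if "\<And>k. \<bar>c k\<bar> \<le> 1" for c :: "nat \<Rightarrow> real"
    by (rule summable_comparison_test'[OF sums_summable[OF geo[of 0]], of 0])
      (use that in \<open>auto simp: field_simps abs_mult\<close>)
  have "\<bar>a k\<bar> \<le> 1" "\<bar>b k\<bar> \<le> 1" "\<bar>a k - b k\<bar> \<le> 1" for k
    using ab(1)[of k] ab(2)[of k] by auto
  note le1 = this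
  have sa: "summable (\<lambda>k. a k / 3 ^ Suc k)" and sb: "summable (\<lambda>k. b k / 3 ^ Suc k)"
    and sd: "summable d"
    using summ[of a] summ[of b] summ[of "\<lambda>k. a k - b k"] le1 by (auto simp: d_def[abs_def])
  have "suminf (\<lambda>k. a k / 3 ^ Suc k) - suminf (\<lambda>k. b k / 3 ^ Suc k) = suminf (\<lambda>k. d k)"
    using suminf_diff[OF sa sb] by (simp add: d_def diff_divide_distrib)
  also have "\<dots> = suminf (\<lambda>k. d (k + Suc l)) + (\<Sum>k<Suc l. d k)"
    by (rule suminf_split_initial_segment[OF sd])
  also have "(\<Sum>k<Suc l. d k) = d l"
    using l(2) by (simp add: d_def)
  finally have eq: "suminf (\<lambda>k. a k / 3 ^ Suc k) - suminf (\<lambda>k. b k / 3 ^ Suc k) = suminf (\<lambda>k. d (k + Suc l)) + d l" .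
  have dle: "\<bar>d k\<bar> \<le> 1 / 3 ^ Suc k" for k
    using le1(3)[of k] by (simp add: d_def field_simps abs_mult)
  have sabs: "summable (\<lambda>k. \<bar>d (k + Suc l)\<bar>)"
    by (rule summable_comparison_test'[OF sums_summable[OF geo[of "Suc l"]], of 0])
      (unfold real_norm_def abs_idempotent, rule dle)
  have "\<bar>suminf (\<lambda>k. d (k + Suc l))\<bar> \<le> suminf (\<lambda>k. \<bar>d (k + Suc l)\<bar>)"
    by (rule summable_rabs[OF sabs])
  also have "\<dots> \<le> suminf (\<lambda>k. 1 / 3 ^ Suc (k + Suc l))"
    by (rule suminf_le[OF _ sabs sums_summable[OF geo]]) (rule dle)
  also have "\<dots> = 1 / (2 * 3 ^ Suc l)"
    by (rule sums_unique[OF geo, symmetric])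
  finally have tail: "\<bar>suminf (\<lambda>k. d (k + Suc l))\<bar> \<le> 1 / (2 * 3 ^ Suc l)" .
  have "\<bar>a l - b l\<bar> = 1"
    using l(1) ab(1)[of l] ab(2)[of l] by auto
  then have "\<bar>d l\<bar> = 1 / 3 ^ Suc l"
    by (simp add: d_def)
  moreover have "1 / 3 ^ Suc l - 1 / (2 * 3 ^ Suc l) = 1 / (2 * 3 ^ Suc l :: real)"
    by (simp add: field_simps)
  ultimately have "1 / (2 * 3 ^ Suc l) \<le> \<bar>suminf (\<lambda>k. a k / 3 ^ Suc k) - suminf (\<lambda>k. b k / 3 ^ Suc k)\<bar>"
    unfolding eq using tail by linarith
  moreover have "(1::real) / (2 * 3 ^ Suc m) \<le> 1 / (2 * 3 ^ Suc l)"
    using l(3) by (intro divide_left_mono mult_left_mono power_increasing) auto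
  ultimately show False
    using close by linarith
qed

text \<open>\<open>h x\<close> records in ternary digits which sets of a countable base contain \<open>x\<close>; on a compact set
  finitely many of these digits locate \<open>x\<close> up to \<open>\<epsilon>\<close>.\<close>
lemma compact_real_coding:
  fixes K :: "'a::euclidean_space set"
  assumes "compact K"
  obtains h :: "'a \<Rightarrow> real" and D :: "real \<Rightarrow> 'a" and R
  where "\<And>x. \<bar>h x\<bar> \<le> 1" "continuous_on UNIV D" "\<And>t. norm (D t) \<le> R" "\<And>x. x \<in> K \<Longrightarrow> D (h x) = x"
proof -
  obtain \<B> :: "'a set set" where \<B>: "countable \<B>" "topological_basis \<B>"
    using ex_countable_basis by blast
  have "\<B> \<noteq> {}"
    using topological_basisE[OF \<B>(2) open_UNIV UNIV_I] by blast
  define U where "U = from_nat_into \<B>"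
  define b where "b x k = (if x \<in> U k then 1 else 0 :: real)" for x k
  define h where "h x = suminf (\<lambda>k. b x k / 3 ^ Suc k)" for x
  have b01: "b x k \<in> {0, 1}" for x k
    by (simp add: b_def)
  have "(\<lambda>k. 1 / 3 ^ Suc k :: real) sums (1 / 2)"
    using sums_mult[OF geometric_sums[of "1/3::real"], of "1 / 3"]
    by (simp add: power_one_over field_simps)
  note geo = this
  have h1: "\<bar>h x\<bar> \<le> 1" for x
  proof -
    have le: "b x k / 3 ^ Suc k \<le> 1 / 3 ^ Suc k" "0 \<le> b x k / 3 ^ Suc k" for k
      by (simp_all add: b_def)
    have summ: "summable (\<lambda>k. b x k / 3 ^ Suc k)"
      by (rule summable_comparison_test'[OF sums_summable[OF geo], of 0]) (simp add: b_def)
    have "0 \<le> h x" "h x \<le> 1 / 2"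
      unfolding h_def sums_unique[OF geo]
      by (rule suminf_nonneg[OF summ le(2)], rule suminf_le[OF le(1) summ sums_summable[OF geo]])
    then show ?thesis
      by simp
  qed
  have sep: "\<exists>\<delta>>0. \<forall>x\<in>K. \<forall>y\<in>K. \<bar>h x - h y\<bar> < \<delta> \<longrightarrow> dist x y < \<epsilon>" if "\<epsilon> > 0" for \<epsilon>
  proof -
    define J where "J = {k. \<forall>y\<in>U k. \<forall>z\<in>U k. dist y z < \<epsilon>}"
    have op: "open (U k)" for k
      unfolding U_def by (rule topological_basis_open[OF \<B>(2) from_nat_into[OF \<open>\<B> \<noteq> {}\<close>]])
    have "K \<subseteq> (\<Union>k\<in>J. U k)"
    proof
      fix x assume "x \<in> K"
      obtain V where V: "V \<in> \<B>" "x \<in> V" "V \<subseteq> ball x (\<epsilon> / 2)"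
        using topological_basisE[OF \<B>(2), of "ball x (\<epsilon> / 2)" x] \<open>\<epsilon> > 0\<close> by auto
      then obtain k where "V = U k"
        using from_nat_into_surj[OF \<B>(1)] by (metis U_def)
      moreover have "dist y z < \<epsilon>" if "y \<in> V" "z \<in> V" for y z
      proof -
        have "dist x y < \<epsilon> / 2" "dist x z < \<epsilon> / 2"
          using V(3) that by auto
        then show ?thesis
          using dist_triangle_half_r by blast
      qed
      ultimately show "x \<in> (\<Union>k\<in>J. U k)"
        using V by (auto simp: J_def)
    qed
    then obtain I where I: "I \<subseteq> J" "finite I" "K \<subseteq> (\<Union>k\<in>I. U k)"
      using compactE_image[OF assms, of J U] op by blast
    \<comment> \<open>The last digit that the finite subcover consults; inserting 0 covers an empty
      \<open>I\<close>.\<close>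
    define m where "m = Max (insert 0 I)"
    have "dist x y < \<epsilon>" if xy: "x \<in> K" "y \<in> K" "\<bar>h x - h y\<bar> < 1 / (2 * 3 ^ Suc m)" for x y
    proof -
      obtain k where k: "k \<in> I" "x \<in> U k"
        using I xy by blast
      then have "k \<le> m"
        unfolding m_def using I(2) by auto
      then have "b x k = b y k"
        using ternary_digits_agree[of "b x" "b y" m k] b01 xy(3) by (simp add: h_def)
      then have "y \<in> U k"
        using k by (simp add: b_def split: if_splits)
      then show ?thesis
        using k I(1) by (auto simp: J_def)
    qed
    then show ?thesis
      by (intro exI[of _ "1 / (2 * 3 ^ Suc m)"]) auto
  qed
  have inj: "inj_on h K"
  proof (rule inj_onI, rule ccontr)
    fix x y assume xy: "x \<in> K" "y \<in> K" "h x = h y" "x \<noteq> y"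
    then show False
      using sep[of "dist x y"] by force
  qed
  \<comment> \<open>\<open>h\<close> may jump at the boundary of a base set, but by
    \<open>sep\<close> its inverse is uniformly continuous on the image of \<open>K\<close> and so
    extends to the closure.\<close>
  define g where "g = inv_into K h"
  have g: "g (h x) = x" if "x \<in> K" for x
    using that inj by (simp add: g_def)
  have "uniformly_continuous_on (h ` K) g"
    unfolding uniformly_continuous_on_def
  proof (intro allI impI)
    fix \<epsilon> :: real assume "\<epsilon> > 0"
    then obtain \<delta> where "\<delta> > 0" "\<And>x y. x \<in> K \<Longrightarrow> y \<in> K \<Longrightarrow> \<bar>h x - h y\<bar> < \<delta> \<Longrightarrow> dist x y < \<epsilon>"
      using sep by blast
    then show "\<exists>d>0. \<forall>x\<in>h ` K. \<forall>x'\<in>h ` K. dist x' x < d \<longrightarrow> dist (g x') (g x) < \<epsilon>"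
      by (intro exI[of _ \<delta>]) (auto simp: g dist_real_def)
  qed
  then obtain g' where g': "uniformly_continuous_on (closure (h ` K)) g'"
    "\<And>t. t \<in> h ` K \<Longrightarrow> g t = g' t"
    by (rule uniformly_continuous_on_extension_on_closure) blast
  have cont: "continuous_on (closure (h ` K)) g'"
    using g'(1) by (rule uniformly_continuous_imp_continuous)
  have "bounded (h ` K)"
    using h1 by (intro boundedI[of _ 1]) auto
  then have "bounded (g' ` closure (h ` K))"
    using compact_continuous_image[OF cont] compact_closure compact_imp_bounded by blast
  then obtain R where R: "R > 0" "g' ` closure (h ` K) \<subseteq> cball 0 R"
    by (force simp: bounded_pos)
  \<comment> \<open>The extension to the whole line stays in a ball because weak convergence will be
    tested on bounded continuous functions.\<close>
  obtain D where D: "continuous_on UNIV D" "D ` UNIV \<subseteq> cball 0 R"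
    "\<And>t. t \<in> closure (h ` K) \<Longrightarrow> D t = g' t"
    by (rule Dugundji[OF convex_cball _ _ cont R(2), of UNIV]) (use R(1) in auto)
  show ?thesis
  proof
    show "D (h x) = x" if "x \<in> K" for x
      using that D(3)[of "h x"] g'(2)[of "h x"] g[OF that] closure_subset[of "h ` K"] by auto
    show "norm (D t) \<le> R" for t
      using D(2) by (simp add: image_subset_iff)
  qed (use h1 D(1) in auto)
qed

section \<open>A representing measure as a weak limit\<close>

text \<open>Averages over points of \<open>K\<close> match more and more of the \<open>v i\<close>.
  Coded by \<open>h\<close> they form a tight sequence on the line, and the image under
  \<open>D\<close> of a weak limit is the measure sought.\<close>

theorem compact_moment_problem:
  fixes K :: "'a::euclidean_space set" and e :: "'i \<Rightarrow> 'a \<Rightarrow> real" and v :: "'i \<Rightarrow> real"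
  assumes "compact K" "countable (UNIV :: 'i set)" and cont: "\<And>i. continuous_on UNIV (e i)"
    and sep: "\<And>A w b. finite A \<Longrightarrow> (\<And>x. x \<in> K \<Longrightarrow> b \<le> (\<Sum>i\<in>A. w i * e i x)) \<Longrightarrow> b \<le> (\<Sum>i\<in>A. w i * v i)"
  obtains \<mu> where "sets \<mu> = sets borel" "prob_space \<mu>" "emeasure \<mu> (UNIV - K) = 0"
    "\<And>i. v i = (\<integral>x. e i x \<partial>\<mu>)"
proof -
  obtain h :: "'a \<Rightarrow> real" and D R where hD: "\<And>x. \<bar>h x\<bar> \<le> 1" "continuous_on UNIV D"
    "\<And>t. norm (D t) \<le> R" "\<And>x. x \<in> K \<Longrightarrow> D (h x) = x"
    using compact_real_coding[OF \<open>compact K\<close>] by metis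
  have bound: "\<exists>B. \<forall>x\<in>S. \<bar>f x\<bar> \<le> B" if "compact S" "continuous_on UNIV f" for S and f :: "'a \<Rightarrow> real"
    using compact_imp_bounded[OF compact_continuous_image[OF continuous_on_subset[OF that(2)] that(1)]]
    by (auto simp: bounded_iff)
  obtain B where B: "\<And>i x. x \<in> K \<Longrightarrow> \<bar>e i x\<bar> \<le> B i"
    using bound[OF \<open>compact K\<close> cont] by metis
  \<comment> \<open>Finite sets that exhaust the index type: every \<open>i\<close> belongs to
    \<open>A k\<close> for all large \<open>k\<close>.\<close>
  define A :: "nat \<Rightarrow> 'i set" where "A k = {i. to_nat_on UNIV i \<le> k}" for k
  have finA: "finite (A k)" for k
    using finite_vimageI[OF _ inj_on_to_nat_on[OF \<open>countable (UNIV :: 'i set)\<close>], of "{..k}"] by (simp add: A_def vimage_def)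
  have "\<exists>N x. N > 0 \<and> (\<forall>j. x j \<in> K) \<and> (\<forall>i\<in>A k. \<bar>(\<Sum>j<N. e i (x j)) / real N - v i\<bar> < 1 / real (Suc k))"
    for k
    by (rule greedy_average[of "A k" "1 / real (Suc k)" K e B v]) (use finA B sep in auto)
  then obtain N x where Nx: "\<And>k. N k > 0" "\<And>k j. x k j \<in> K"
    "\<And>k i. i \<in> A k \<Longrightarrow> \<bar>(\<Sum>j<N k. e i (x k j)) / real (N k) - v i\<bar> < 1 / real (Suc k)"
    by metis
  define \<mu> where "\<mu> k = distr (measure_pmf (pmf_of_set {..<N k})) borel (\<lambda>j. h (x k j))" for k
  have rd: "real_distribution (\<mu> k)" for k
    unfolding \<mu>_def by (intro prob_space.real_distribution_distr measure_pmf.prob_space_axioms) auto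
  \<comment> \<open>Tightness is phrased with half-open intervals; this one contains all values of
    \<open>h\<close> and serves every tolerance.\<close>
  have "measure (\<mu> k) {-2<..2} = 1" for k
  proof -
    have "h y \<in> {-2<..2}" for y
      using hD(1)[of y] by auto
    then have "(\<lambda>j. h (x k j)) -` {-2<..2} = UNIV"
      by blast
    then show ?thesis
      by (simp add: \<mu>_def measure_distr measure_pmf.prob_space)
  qed
  then have "tight \<mu>"
    unfolding tight_def using rd by (intro conjI allI impI exI[of _ "-2"] exI[of _ 2]) simp_all
  from tight_imp_convergent_subsubsequence[OF this strict_mono_id] obtain r M where
    r: "strict_mono (r :: nat \<Rightarrow> nat)" "real_distribution M" "weak_conv_m (\<lambda>n. \<mu> (r n)) M"
    by (auto simp: o_def)
  interpret M: real_distribution M by fact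
  have lim: "(\<lambda>n. (\<Sum>j<N (r n). f (x (r n) j)) / real (N (r n))) \<longlonglongrightarrow> (\<integral>t. f (D t) \<partial>M)"
    if f: "continuous_on UNIV f" for f :: "'a \<Rightarrow> real"
  proof -
    obtain C where C: "\<And>y. y \<in> cball 0 R \<Longrightarrow> \<bar>f y\<bar> \<le> C"
      using bound[OF compact_cball f] by blast
    have cfD: "continuous_on UNIV (\<lambda>t. f (D t))"
      using continuous_on_compose2[OF f hD(2)] by auto
    have "(\<lambda>n. \<integral>t. f (D t) \<partial>\<mu> (r n)) \<longlonglongrightarrow> (\<integral>t. f (D t) \<partial>M)"
    proof (rule weak_conv_imp_integral_bdd_continuous_conv[OF rd r(2,3)])
      show "isCont (\<lambda>t. f (D t)) t" for t
        using cfD by (simp add: continuous_on_eq_continuous_at)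
      show "norm (f (D t)) \<le> C" for t
        using C[of "D t"] hD(3)[of t] by simp
    qed
    \<comment> \<open>Since \<open>D\<close> inverts \<open>h\<close> on \<open>K\<close>,
      integrating along the coded points returns the original average.\<close>
    moreover have "(\<integral>t. f (D t) \<partial>\<mu> k) = (\<Sum>j<N k. f (x k j)) / real (N k)" for k
    proof -
      have "(\<integral>t. f (D t) \<partial>\<mu> k) = (\<integral>j. f (D (h (x k j))) \<partial>measure_pmf (pmf_of_set {..<N k}))"
        unfolding \<mu>_def by (intro integral_distr borel_measurable_continuous_onI cfD) auto
      also have "\<dots> = (\<Sum>j<N k. f (x k j)) / real (N k)"
        using Nx(1)[of k] by (subst integral_pmf_of_set) (auto simp: hD(4) Nx(2) lessThan_empty_iff)
      finally show ?thesis .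
    qed
    ultimately show ?thesis by simp
  qed
  have Dm[measurable]: "D \<in> borel_measurable M"
    using borel_measurable_continuous_onI[OF hD(2)] by (simp add: measurable_def)
  define \<nu> where "\<nu> = distr M borel D"
  have int\<nu>: "(\<integral>x. f x \<partial>\<nu>) = (\<integral>t. f (D t) \<partial>M)" if "continuous_on UNIV f" for f :: "'a \<Rightarrow> real"
    unfolding \<nu>_def by (intro integral_distr borel_measurable_continuous_onI that) measurable
  show ?thesis
  proof
    show "sets \<nu> = sets borel"
      by (simp add: \<nu>_def)
    show "prob_space \<nu>"
      unfolding \<nu>_def by (rule M.prob_space_distr[OF Dm])
    show "v i = (\<integral>x. e i x \<partial>\<nu>)" for i
    proof -
      have "(\<lambda>k. (\<Sum>j<N k. e i (x k j)) / real (N k) - v i) \<longlonglongrightarrow> 0"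
      proof (rule Lim_null_comparison[OF _ LIMSEQ_inverse_real_of_nat])
        show "\<forall>\<^sub>F k in sequentially.
            norm ((\<Sum>j<N k. e i (x k j)) / real (N k) - v i) \<le> inverse (real (Suc k))"
          using eventually_ge_at_top[of "to_nat_on UNIV i"]
        proof eventually_elim
          case (elim k)
          then show ?case
            using Nx(3)[of i k] by (simp add: A_def inverse_eq_divide)
        qed
      qed
      from LIMSEQ_subseq_LIMSEQ[OF this r(1)]
      have "(\<lambda>n. (\<Sum>j<N (r n). e i (x (r n) j)) / real (N (r n))) \<longlonglongrightarrow> v i"
        by (simp add: o_def LIM_zero_iff)
      from LIMSEQ_unique[OF this lim[OF cont]] show ?thesis
        by (simp add: int\<nu>[OF cont])
    qed
    \<comment> \<open>The distance to an empty set is 0 by convention, so this must be known before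
      distance 0 can mean membership.\<close>
    have "K \<noteq> {}"
      using Nx(2) by blast
    have ci: "continuous_on UNIV (\<lambda>y. infdist y K)"
      by (intro continuous_intros)
    \<comment> \<open>The limit on the line may charge points outside the image of \<open>K\<close>
      under \<open>h\<close>. The distance to \<open>K\<close> integrates to 0 along the averages,
      hence also in the limit.\<close>
    have "(\<integral>t. infdist (D t) K \<partial>M) = 0"
      using LIMSEQ_unique[OF lim[OF ci]] Nx(2) by simp
    moreover have "integrable M (\<lambda>t. infdist (D t) K)"
    proof -
      obtain C where C: "\<And>y. y \<in> cball 0 R \<Longrightarrow> \<bar>infdist y K\<bar> \<le> C"
        using bound[OF compact_cball ci] by blast
      show ?thesis
        by (rule M.integrable_const_bound[of _ C])
          (use C hD(3) in \<open>auto intro!: measurable_compose[OF Dm] borel_measurable_continuous_onI ci\<close>)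
    qed
    ultimately have "AE t in M. infdist (D t) K = 0"
      by (subst (asm) integral_nonneg_eq_0_iff_AE) (auto simp: infdist_nonneg)
    then have "AE t in M. D t \<in> K"
      by eventually_elim (use \<open>compact K\<close> \<open>K \<noteq> {}\<close> in \<open>auto simp: in_closed_iff_infdist_zero compact_imp_closed\<close>)
    moreover have KB: "UNIV - K \<in> sets borel" "K \<in> sets borel"
      using borel_closed[OF compact_imp_closed[OF \<open>compact K\<close>]] by auto
    ultimately have "AE x in \<nu>. x \<in> K"
      unfolding \<nu>_def by (subst AE_distr_iff[OF Dm]) (use KB in simp_all)
    then show "emeasure \<nu> (UNIV - K) = 0"
      by (subst (asm) AE_iff_measurable[of "UNIV - K"]) (use KB in \<open>auto simp: \<nu>_def\<close>)
  qed
qed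

section \<open>The moment rings\<close>

text \<open>The moment map is not multiplicative, so the induction is run for \<open>p\<close>
  multiplied by an arbitrary square, into which further square factors merge before the map is
  applied.\<close>

lemma qm_mom_map:
  assumes "p \<in> QM1 S1"
  shows "mom_map (X_to_MX p) \<in> qm S1 S2"
proof -
  have "mom_map (X_to_MX (a\<^sup>2 * p)) \<in> qm S1 S2" for a
    using assms unfolding QM1_def
  proof (induction arbitrary: a)
    case qm_one
    have "mom_map ((X_to_MX a)\<^sup>2 * X_to_MX 1) \<in> mom_gens S1"
      unfolding mom_gens_def by blast
    then show ?case
      by (auto simp: qm_def power2_eq_square X_to_MX_mult X_to_MX_one intro: qm_gen)
  next
    case (qm_gen s)
    then have "mom_map ((X_to_MX a)\<^sup>2 * X_to_MX s) \<in> mom_gens S1"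
      unfolding mom_gens_def by blast
    then show ?case
      by (auto simp: qm_def power2_eq_square X_to_MX_mult intro: qmod_gen.qm_gen)
  next
    case (qm_add p q)
    then show ?case
      by (simp add: qm_def distrib_left X_to_MX_add mom_map_add qmod_gen.qm_add)
  next
    case (qm_sq p b)
    from qm_sq.IH[of "a * b"] show ?case
      by (simp add: power_mult_distrib mult.assoc)
  qed
  from this[of 1] show ?thesis
    by simp
qed

lemma X_to_MX_QM2:
  assumes "p \<in> QM1 S1"
  shows "X_to_MX p \<in> QM2 S1 S2"
  using assms unfolding QM1_def
proof induction
  case (qm_sq b a)
  then show ?case
    using qmod_gen.qm_sq[of "X_to_MX b" _ "X_to_MX a"] by (simp add: QM2_def X_to_MX_mult power2_eq_square)
qed (auto simp: QM2_def X_to_MX_one X_to_MX_add intro: qmod_gen.intros)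

lemma M_to_MX_QM2:
  assumes "g \<in> qm S1 S2"
  shows "M_to_MX g \<in> QM2 S1 S2"
  using assms unfolding qm_def
proof induction
  case (qm_sq b a)
  then show ?case
    using qmod_gen.qm_sq[of "M_to_MX b" _ "M_to_MX a"] by (simp add: QM2_def M_to_MX_simps power2_eq_square)
qed (auto simp: QM2_def M_to_MX_simps intro: qmod_gen.intros)

lemma mom_map_X_to_MX_const: "mom_map (X_to_MX (Poly_Mapping.single 0 r)) = Poly_Mapping.single 0 r"
  by (simp add: X_to_MX_single mom_map_single mvar_zero mconst_def)

section \<open>Consequences of archimedeanity\<close>

context
  fixes S1 :: "'n::finite xpoly set" and S2 :: "'n mpoly set"
  assumes arch: "archimedean_qm (QM1 S1)"
begin

lemma bdd_QM1: "pm.bdd (QM1 S1) = UNIV"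
  using arch by (simp add: QM1_def pm.archimedean_qm_iff[OF quadratic_module_qmod_gen])

lemma QM1_bound:
  obtains r where "Poly_Mapping.single 0 r + p \<in> QM1 S1" "Poly_Mapping.single 0 r - p \<in> QM1 S1"
  using bdd_QM1 by (auto simp: pm.bdd_def)

lemma mvar_bdd_qm: "mvar \<alpha> \<in> pm.bdd (qm S1 S2)"
proof -
  obtain r where r: "Poly_Mapping.single 0 r + Poly_Mapping.single \<alpha> 1 \<in> QM1 S1"
    "Poly_Mapping.single 0 r - Poly_Mapping.single \<alpha> 1 \<in> QM1 S1"
    using QM1_bound by blast
  have "mom_map (X_to_MX (Poly_Mapping.single \<alpha> 1)) = mvar \<alpha>"
    by (simp add: X_to_MX_single mom_map_single mconst_def)
  then have "Poly_Mapping.single 0 r + mvar \<alpha> \<in> qm S1 S2" "Poly_Mapping.single 0 r - mvar \<alpha> \<in> qm S1 S2"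
    using r[THEN qm_mom_map, of S2]
    by (simp_all add: X_to_MX_add mom_map_add mom_map_X_to_MX_const X_to_MX_minus mom_map_minus
        diff_conv_add_uminus del: add_uminus_conv_diff)
  then show ?thesis
    by (auto simp: pm.bdd_def)
qed

text \<open>Bounded elements are closed under sums, products and scaling, so the bounds on the
  formal moments spread to the whole moment ring.\<close>

lemma bdd_qm: "pm.bdd (qm S1 S2) = UNIV"
proof -
  have qm: "quadratic_module (qm S1 S2)"
    unfolding qm_def by (rule quadratic_module_qmod_gen)
  have "g \<in> pm.bdd (qm S1 S2)" for g
  proof (induction g rule: poly_mapping_single_induct)
    case (single \<beta> a)
    have "Poly_Mapping.single \<beta> 1 \<in> pm.bdd (qm S1 S2)"
      using mvar_bdd_qm[of "Rep_midx _"]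
      by (subst monomial_as_product) (intro pm.bdd_prod pm.bdd_power qm, simp add: mvar_Rep_midx)
    from pm.bdd_scale[OF qm this, of a] show ?case
      by (simp add: mult_single)
  qed (use pm.bdd_const[OF qm, of 0] in \<open>auto simp: pm.bdd_add[OF qm]\<close>)
  then show ?thesis by blast
qed

text \<open>Both embedded rings are bounded by transported certificates, and together they generate
  the mixed ring.\<close>

lemma bdd_QM2: "mx.bdd (QM2 S1 S2) = UNIV"
proof -
  have qm: "quadratic_module (QM2 S1 S2)"
    unfolding QM2_def by (rule quadratic_module_qmod_gen)
  have X: "X_to_MX p \<in> mx.bdd (QM2 S1 S2)" for p
  proof -
    obtain r where "Poly_Mapping.single 0 r + p \<in> QM1 S1" "Poly_Mapping.single 0 r - p \<in> QM1 S1"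
      using QM1_bound by blast
    from this[THEN X_to_MX_QM2, of S2] show ?thesis
      by (auto simp: mx.bdd_def X_to_MX_add X_to_MX_const X_to_MX_minus
        diff_conv_add_uminus simp del: add_uminus_conv_diff)
  qed
  have M: "M_to_MX g \<in> mx.bdd (QM2 S1 S2)" for g
  proof -
    obtain r where "mconst r + g \<in> qm S1 S2" "mconst r + - g \<in> qm S1 S2"
      using bdd_qm by (auto simp: pm.bdd_def mconst_def)
    moreover have "M_to_MX (- g) = - M_to_MX g"
      by (simp add: M_to_MX_def single_uminus)
    ultimately have "mxconst r + M_to_MX g \<in> QM2 S1 S2" "mxconst r + - M_to_MX g \<in> QM2 S1 S2"
      using M_to_MX_QM2[of "mconst r + g" S1 S2] M_to_MX_QM2[of "mconst r + - g" S1 S2]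
      by (simp_all only: M_to_MX_simps)
    then show ?thesis
      by (auto simp: mx.bdd_def)
  qed
  have "f \<in> mx.bdd (QM2 S1 S2)" for f
    by (subst mx_decompose) (intro mx.bdd_sum mx.bdd_mult X M qm)
  then show ?thesis by blast
qed

lemma eval_x_QM1_nonneg: "p \<in> QM1 S1 \<Longrightarrow> X \<in> Kset S1 \<Longrightarrow> 0 \<le> eval_x p X"
  unfolding QM1_def by (auto simp: Kset_def intro: pm.qmod_gen_nonneg[OF real_hom_eval_x])

text \<open>Characters of the polynomial ring are point evaluations, and nonnegativity on
  \<open>QM1 S1\<close> places the point in \<open>Kset S1\<close>.\<close>

lemma nonneg_on_Kset_imp_QM1:
  assumes "\<And>X. X \<in> Kset S1 \<Longrightarrow> 0 \<le> eval_x p X" "\<epsilon> > 0"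
  shows "p + Poly_Mapping.single 0 \<epsilon> \<in> QM1 S1"
proof (rule pm.archimedean_positivstellensatz)
  show "quadratic_module (QM1 S1)"
    unfolding QM1_def by (rule quadratic_module_qmod_gen)
next
  fix \<phi> :: "'n xpoly \<Rightarrow> real"
  assume \<phi>: "pm.real_hom \<phi>" "\<And>a. a \<in> QM1 S1 \<Longrightarrow> 0 \<le> \<phi> a"
  have "(\<chi> i. \<phi> (Poly_Mapping.single (Poly_Mapping.single i 1) 1)) \<in> Kset S1"
    unfolding Kset_def QM1_def using \<phi>(2) qm_gen
    by (auto simp: QM1_def simp del: One_nat_def simp flip: real_hom_eq_eval_x[OF \<phi>(1)])
  then show "0 \<le> \<phi> p"
    by (subst real_hom_eq_eval_x[OF \<phi>(1)]) (rule assms(1))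
qed (fact bdd_QM1 assms(2))+

text \<open>Boundedness comes from evaluating the certificates for r + x_i and r - x_i at a point of
  the set.\<close>

lemma compact_Kset: "compact (Kset S1)"
proof -
  have "Kset S1 = (\<Inter>p\<in>S1. {X. 0 \<le> eval_x p X})"
    by (auto simp: Kset_def)
  then have "closed (Kset S1)"
    by (auto intro!: closed_INT closed_Collect_le continuous_on_eval_x)
  moreover have "\<exists>r. \<forall>X\<in>Kset S1. \<bar>X $ i\<bar> \<le> r" for i
  proof -
    obtain r where r: "Poly_Mapping.single 0 r + Poly_Mapping.single (Poly_Mapping.single i 1) 1 \<in> QM1 S1"
      "Poly_Mapping.single 0 r - Poly_Mapping.single (Poly_Mapping.single i 1) 1 \<in> QM1 S1"
      using QM1_bound by blast
    have "\<bar>X $ i\<bar> \<le> r" if "X \<in> Kset S1" for X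
      using r[THEN eval_x_QM1_nonneg[OF _ that]]
      by (simp add: pm.real_homD[OF real_hom_eval_x] eval_x_single xmono_eq_monomial_eval monomial_eval_single_one
          monomial_eval_zero abs_le_iff del: One_nat_def)
    then show ?thesis by blast
  qed
  then obtain r where r: "\<And>i X. X \<in> Kset S1 \<Longrightarrow> \<bar>X $ i\<bar> \<le> r i"
    by metis
  have "bounded (Kset S1)"
  proof (rule boundedI)
    fix X assume "X \<in> Kset S1"
    then show "norm X \<le> (\<Sum>i\<in>UNIV. r i)"
      using r by (intro order_trans[OF norm_le_l1_cart] sum_mono)
  qed
  ultimately show ?thesis
    by (simp add: compact_eq_bounded_closed)
qed

lemma AE_Kset:
  assumes "sets \<mu> = sets borel" "emeasure \<mu> (UNIV - Kset S1) = 0"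
  shows "AE x in \<mu>. x \<in> Kset S1"
  using assms compact_Kset sets_eq_imp_space_eq[OF assms(1)]
  by (subst AE_iff_measurable[of "UNIV - Kset S1"]) (auto intro: borel_closed compact_imp_closed)

lemma integrable_continuous:
  fixes f :: "real ^ 'n \<Rightarrow> real"
  assumes "sets \<mu> = sets borel" "prob_space \<mu>" "emeasure \<mu> (UNIV - Kset S1) = 0" "continuous_on UNIV f"
  shows "integrable \<mu> f"
proof -
  interpret prob_space \<mu> by fact
  have "bounded (f ` Kset S1)"
    using compact_Kset assms(4) by (metis compact_continuous_image compact_imp_bounded continuous_on_subset subset_UNIV)
  then obtain B where B: "\<And>x. x \<in> Kset S1 \<Longrightarrow> norm (f x) \<le> B"
    by (auto simp: bounded_iff)
  have "f \<in> borel_measurable \<mu>"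
    using borel_measurable_continuous_onI[OF assms(4)] assms(1) by (simp cong: measurable_cong_sets)
  moreover have "AE x in \<mu>. norm (f x) \<le> B"
    using AE_Kset[OF assms(1,3)] by eventually_elim (rule B)
  ultimately show ?thesis
    by (intro integrable_const_bound)
qed

text \<open>A point of the spectrum of \<open>qm(S1, S2)\<close> is a linear functional on polynomials that is nonnegative
  on \<open>QM(S1)\<close>, hence on all polynomials that are nonnegative on the compact set \<open>K(S1)\<close>.\<close>
lemma real_hom_qm_eq_eval_m:
  assumes \<phi>: "pm.real_hom \<phi>" "\<And>g. g \<in> qm S1 S2 \<Longrightarrow> 0 \<le> \<phi> g"
  obtains \<mu> where "\<mu> \<in> Kmeas S1 S2" "\<And>g. \<phi> g = eval_m \<mu> g"
proof -
  define L where "L p = \<phi> (mom_map (X_to_MX p))" for p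
  have L_add: "L (p + q) = L p + L q" for p q
    by (simp add: L_def X_to_MX_add mom_map_add pm.real_homD[OF \<phi>(1)])
  have L_single: "L (Poly_Mapping.single \<alpha> a) = a * \<phi> (mvar \<alpha>)" for \<alpha> a
    by (simp add: L_def X_to_MX_single mom_map_single mconst_def pm.real_homD[OF \<phi>(1)])
  have L_const: "L (Poly_Mapping.single 0 a) = a" for a
    by (simp add: L_single mvar_zero pm.real_homD[OF \<phi>(1)])
  have L_sum: "L (sum f A) = (\<Sum>\<alpha>\<in>A. L (f \<alpha>))" for f and A :: "('n \<Rightarrow>\<^sub>0 nat) set"
    by (induction A rule: infinite_finite_induct) (use L_const[of 0] in \<open>simp_all add: L_add\<close>)
  have L_nonneg: "0 \<le> L p" if "\<And>X. X \<in> Kset S1 \<Longrightarrow> 0 \<le> eval_x p X" for p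
  \<comment> \<open>Only \<open>p\<close> plus a positive constant is known to lie in
    \<open>QM1 S1\<close>, so the constant is sent to 0.\<close>
  proof (rule field_le_epsilon)
    fix \<epsilon> :: real assume "\<epsilon> > 0"
    from nonneg_on_Kset_imp_QM1[OF that this] have "0 \<le> L (p + Poly_Mapping.single 0 \<epsilon>)"
      unfolding L_def by (intro \<phi>(2) qm_mom_map)
    then show "0 \<le> L p + \<epsilon>"
      by (simp add: L_add L_const)
  qed
  obtain \<mu> where \<mu>: "sets \<mu> = sets borel" "prob_space \<mu>" "emeasure \<mu> (UNIV - Kset S1) = 0"
    "\<And>\<alpha>. \<phi> (mvar \<alpha>) = (\<integral>x. xmono \<alpha> x \<partial>\<mu>)"
  proof (rule compact_moment_problem[OF compact_Kset countable_multi_indices continuous_on_xmono])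
    fix A :: "('n \<Rightarrow>\<^sub>0 nat) set" and w :: "('n \<Rightarrow>\<^sub>0 nat) \<Rightarrow> real" and b :: real
    assume "finite A" and b: "\<And>X. X \<in> Kset S1 \<Longrightarrow> b \<le> (\<Sum>\<alpha>\<in>A. w \<alpha> * xmono \<alpha> X)"
    \<comment> \<open>Moving \<open>b\<close> to the other side turns the separation hypothesis into
      nonnegativity of \<open>L\<close> at a polynomial that is nonnegative on
      \<open>Kset S1\<close>.\<close>
    define p where "p = (\<Sum>\<alpha>\<in>A. Poly_Mapping.single \<alpha> (w \<alpha>)) + Poly_Mapping.single 0 (- b)"
    have "0 \<le> L p"
      using b by (intro L_nonneg)
        (simp add: p_def pm.real_homD(2)[OF real_hom_eval_x] pm.real_hom_sum[OF real_hom_eval_x] eval_x_single xmono_zero)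
    then show "b \<le> (\<Sum>\<alpha>\<in>A. w \<alpha> * \<phi> (mvar \<alpha>))"
      by (simp add: p_def L_add L_sum L_const L_single[of _ "w _"])
  qed blast
  have eq: "\<phi> g = eval_m \<mu> g" for g
    by (rule real_hom_eq_eval_m[OF \<phi>(1)]) (simp add: \<mu>(4) moment_def)
  have "integrable \<mu> (\<lambda>x. x $ j ^ (2 * k))" for j k
    by (intro integrable_continuous \<mu> continuous_intros)
  moreover have "0 \<le> eval_m \<mu> s" if "s \<in> S2" for s
    using \<phi>(2)[of s] that by (auto simp: qm_def eq intro: qm_gen)
  ultimately have "\<mu> \<in> Kmeas S1 S2"
    using \<mu> by (simp add: Kmeas_def Pmeas_def)
  then show ?thesis
    using eq that by blast
qed

section \<open>Nonnegativity of the evaluations\<close>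

text \<open>The evaluated coefficients do not depend on the integration variable, and all monomials
  are integrable, so linearity turns the formal moment map into integration.\<close>

lemma eval_m_mom_map:
  assumes "\<mu> \<in> Pmeas (Kset S1)"
  shows "eval_m \<mu> (mom_map f) = (\<integral>x. eval_mx \<mu> x f \<partial>\<mu>)"
proof -
  have \<mu>: "sets \<mu> = sets borel" "prob_space \<mu>" "emeasure \<mu> (UNIV - Kset S1) = 0"
    using assms by (simp_all add: Pmeas_def)
  have "integrable \<mu> (\<lambda>x. xmono \<alpha> x)" for \<alpha>
    by (intro integrable_continuous \<mu> continuous_on_xmono)
  then show ?thesis
    by (simp add: mom_map_def eval_mx_def pm.real_hom_sum[OF real_hom_eval_m] pm.real_homD[OF real_hom_eval_m]
        eval_m_mvar[OF \<mu>(2)] moment_def)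
qed

text \<open>The value is the integral of a square times \<open>s\<close>, an integrand that is
  nonnegative on the set carrying the measure.\<close>

lemma eval_m_mom_gens_nonneg:
  assumes "\<mu> \<in> Pmeas (Kset S1)" "g \<in> mom_gens S1"
  shows "0 \<le> eval_m \<mu> g"
proof -
  obtain f s where g: "g = mom_map (f\<^sup>2 * X_to_MX s)" "s \<in> insert 1 S1"
    using assms(2) by (auto simp: mom_gens_def)
  have "AE x in \<mu>. x \<in> Kset S1"
    using assms(1) by (intro AE_Kset) (simp_all add: Pmeas_def)
  then have "AE x in \<mu>. 0 \<le> eval_mx \<mu> x (f\<^sup>2 * X_to_MX s)"
  proof eventually_elim
    case (elim x)
    then have "0 \<le> eval_x s x"
      using g(2) by (auto simp: Kset_def pm.real_homD[OF real_hom_eval_x])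
    then show ?case
      by (simp add: mx.real_homD[OF real_hom_eval_mx] eval_mx_X_to_MX)
  qed
  then show ?thesis
    unfolding g eval_m_mom_map[OF assms(1)] by (rule integral_nonneg_AE)
qed

lemma eval_m_qm_nonneg:
  assumes "\<mu> \<in> Kmeas S1 S2" "g \<in> qm S1 S2"
  shows "0 \<le> eval_m \<mu> g"
  using assms(2) unfolding qm_def
proof (rule pm.qmod_gen_nonneg[OF real_hom_eval_m, rotated])
  show "0 \<le> eval_m \<mu> s" if "s \<in> mom_gens S1 \<union> S2" for s
    using that assms(1) eval_m_mom_gens_nonneg by (auto simp: Kmeas_def)
qed

lemma eval_mx_QM2_nonneg:
  assumes "\<mu> \<in> Kmeas S1 S2" "X \<in> Kset S1" "f \<in> QM2 S1 S2"
  shows "0 \<le> eval_mx \<mu> X f"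
  using assms(3) unfolding QM2_def
proof (rule mx.qmod_gen_nonneg[OF real_hom_eval_mx, rotated])
  show "0 \<le> eval_mx \<mu> X s" if "s \<in> X_to_MX ` S1 \<union> M_to_MX ` mom_gens S1 \<union> M_to_MX ` S2" for s
    using that assms(1,2) eval_m_mom_gens_nonneg
    by (auto simp: Kmeas_def Kset_def eval_mx_X_to_MX eval_mx_M_to_MX)
qed

section \<open>The two equivalences\<close>

text \<open>A character nonnegative on \<open>QM2 S1 S2\<close> restricts to a measure on the moment
  ring and to a point on the polynomial ring; it is evaluation at this pair. Conversely, members
  evaluate nonnegatively and \<open>\<epsilon>\<close> is sent to 0.\<close>

lemma nonneg_iff_QM2:
  "(\<forall>\<mu>\<in>Kmeas S1 S2. \<forall>X\<in>Kset S1. eval_mx \<mu> X f \<ge> 0) \<longleftrightarrow> (\<forall>\<epsilon>>0. f + mxconst \<epsilon> \<in> QM2 S1 S2)"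
proof
  assume nonneg: "\<forall>\<mu>\<in>Kmeas S1 S2. \<forall>X\<in>Kset S1. eval_mx \<mu> X f \<ge> 0"
  show "\<forall>\<epsilon>>0. f + mxconst \<epsilon> \<in> QM2 S1 S2"
  proof (intro allI impI, rule mx.archimedean_positivstellensatz)
    show "quadratic_module (QM2 S1 S2)"
      unfolding QM2_def by (rule quadratic_module_qmod_gen)
    fix \<phi> assume \<phi>: "mx.real_hom \<phi>" "\<And>a. a \<in> QM2 S1 S2 \<Longrightarrow> 0 \<le> \<phi> a"
    obtain \<mu> where \<mu>: "\<mu> \<in> Kmeas S1 S2" "\<And>g. \<phi> (M_to_MX g) = eval_m \<mu> g"
      using real_hom_qm_eq_eval_m[OF real_hom_M_to_MX[OF \<phi>(1)] \<phi>(2)[OF M_to_MX_QM2]] by metis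
    \<comment> \<open>The coordinates are the values of the character at the indeterminates;
      unification supplies the vector.\<close>
    obtain X where X: "\<And>p. \<phi> (X_to_MX p) = eval_x p X"
      by (rule that[OF real_hom_eq_eval_x[OF real_hom_X_to_MX[OF \<phi>(1)]]])
    have "X_to_MX p \<in> QM2 S1 S2" if "p \<in> S1" for p
      unfolding QM2_def using that by (intro qm_gen) blast
    then have "X \<in> Kset S1"
      using \<phi>(2) by (auto simp: Kset_def simp flip: X)
    then have "0 \<le> eval_mx \<mu> X f"
      using nonneg \<mu>(1) by blast
    then show "0 \<le> \<phi> f"
      by (subst real_hom_eq_eval_mx[OF \<phi>(1) \<mu>(2) X])
  qed (simp_all add: bdd_QM2)
next
  assume mem: "\<forall>\<epsilon>>0. f + mxconst \<epsilon> \<in> QM2 S1 S2"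
  show "\<forall>\<mu>\<in>Kmeas S1 S2. \<forall>X\<in>Kset S1. eval_mx \<mu> X f \<ge> 0"
  proof (intro ballI, rule field_le_epsilon)
    fix \<mu> X and \<epsilon> :: real assume "\<mu> \<in> Kmeas S1 S2" "X \<in> Kset S1" "0 < \<epsilon>"
    then show "0 \<le> eval_mx \<mu> X f + \<epsilon>"
      using eval_mx_QM2_nonneg mem by (metis mx.real_homD(1,2)[OF real_hom_eval_mx])
  qed
qed

lemma nonneg_iff_qm:
  "(\<forall>\<mu>\<in>Kmeas S1 S2. eval_m \<mu> f \<ge> 0) \<longleftrightarrow> (\<forall>\<epsilon>>0. f + mconst \<epsilon> \<in> qm S1 S2)"
proof
  assume nonneg: "\<forall>\<mu>\<in>Kmeas S1 S2. eval_m \<mu> f \<ge> 0"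
  show "\<forall>\<epsilon>>0. f + mconst \<epsilon> \<in> qm S1 S2"
    unfolding mconst_def
  proof (intro allI impI, rule pm.archimedean_positivstellensatz)
    show "quadratic_module (qm S1 S2)"
      unfolding qm_def by (rule quadratic_module_qmod_gen)
    fix \<phi> :: "'n mpoly \<Rightarrow> real" assume "pm.real_hom \<phi>" "\<And>a. a \<in> qm S1 S2 \<Longrightarrow> 0 \<le> \<phi> a"
    then obtain \<mu> where "\<mu> \<in> Kmeas S1 S2" "\<And>g. \<phi> g = eval_m \<mu> g"
      using real_hom_qm_eq_eval_m by blast
    then show "0 \<le> \<phi> f"
      using nonneg by simp
  qed (simp_all add: bdd_qm)
next
  assume mem: "\<forall>\<epsilon>>0. f + mconst \<epsilon> \<in> qm S1 S2"
  show "\<forall>\<mu>\<in>Kmeas S1 S2. eval_m \<mu> f \<ge> 0"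
  proof (intro ballI, rule field_le_epsilon)
    fix \<mu> and \<epsilon> :: real assume "\<mu> \<in> Kmeas S1 S2" "0 < \<epsilon>"
    then show "0 \<le> eval_m \<mu> f + \<epsilon>"
      using eval_m_qm_nonneg mem by (metis mconst_def pm.real_homD(1,2)[OF real_hom_eval_m])
  qed
qed

end

theorem theorem4p2:
  fixes S1 :: "'n::finite xpoly set" and S2 :: "'n mpoly set"
  assumes "archimedean_qm (QM1 S1)"
  shows "(\<forall>f :: 'n mxpoly.
            (\<forall>\<mu>\<in>Kmeas S1 S2. \<forall>X\<in>Kset S1. eval_mx \<mu> X f \<ge> 0)
            \<longleftrightarrow> (\<forall>\<epsilon>>0. f + mxconst \<epsilon> \<in> QM2 S1 S2))
       \<and> (\<forall>f :: 'n mpoly.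
            (\<forall>\<mu>\<in>Kmeas S1 S2. eval_m \<mu> f \<ge> 0)
            \<longleftrightarrow> (\<forall>\<epsilon>>0. f + mconst \<epsilon> \<in> qm S1 S2))"
  using nonneg_iff_QM2[OF assms] nonneg_iff_qm[OF assms] by blast

end
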